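(* Let $p$ be a prime, $q=p^l$, $n\ge 2$ and $k\ge1$ integers, $d=\gcd(k,q-1)$, and let $\ell$ be the divisor of $l$ such that the set of all finite sums of $k$-th powers of elements of $\mathbb F_q$ equals the subfield $\mathbb F_{p^\ell}$. Suppose $d\neq q-1$ (then $q-1\ge d(\ell+1)$). If either ($q-1\neq d(\ell+1)$ and $n>\ell(p-1)$) or $n>(\ell+1)(p-1)$, then every cyclic matrix $A\in M_n(\mathbb F_q)$ with $\operatorname{Tr}(A)\in\mathbb F_{p^\ell}$ is of the form $B^k+C^k$ with $B,C\in M_n(\mathbb F_q)$. In particular, if $\ell=l$ and either ($q-1\neq d(l+1)$ and $n>l(p-1)$) or $n>(l+1)(p-1)$, then every cyclic matrix in $M_n(\mathbb F_q)$ is of this form.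
   Context: A matrix $A\in M_n(K)$ is cyclic if its minimal polynomial equals its characteristic polynomial. *)

theory Defs
  imports
    "Jordan_Normal_Form.Char_Poly"
    "HOL-Computational_Algebra.Primes"
    "HOL-Library.Cardinality"
begin

definition mat_trace :: "'a :: comm_monoid_add mat \<Rightarrow> 'a" where
  "mat_trace A = (\<Sum>i<dim_row A. A $$ (i, i))"

text \<open>Evaluation of a polynomial at a square matrix, written entrywise because matrices of
  unspecified dimension do not form a type-class monoid and so have no big sum.\<close>

definition poly_at_mat :: "'a :: comm_ring_1 poly \<Rightarrow> 'a mat \<Rightarrow> 'a mat" where
  "poly_at_mat f A = mat (dim_row A) (dim_row A)
     (\<lambda>(i, j). \<Sum>m\<le>degree f. coeff f m * (A ^\<^sub>m m) $$ (i, j))"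

definition is_min_poly :: "'a :: field mat \<Rightarrow> 'a poly \<Rightarrow> bool" where
  "is_min_poly A f \<longleftrightarrow>
     monic f \<and>
     poly_at_mat f A = 0\<^sub>m (dim_row A) (dim_row A) \<and>
     (\<forall>g. g \<noteq> 0 \<and> poly_at_mat g A = 0\<^sub>m (dim_row A) (dim_row A) \<longrightarrow> degree f \<le> degree g)"

definition cyclic_mat :: "'a :: field mat \<Rightarrow> bool" where
  "cyclic_mat A \<longleftrightarrow> is_min_poly A (char_poly A)"

definition is_subfield :: "'a :: field set \<Rightarrow> bool" where
  "is_subfield F \<longleftrightarrow>
     0 \<in> F \<and> 1 \<in> F \<and>
     (\<forall>x\<in>F. \<forall>y\<in>F. x + y \<in> F \<and> x * y \<in> F) \<and>
     (\<forall>x\<in>F. - x \<in> F) \<and>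
     (\<forall>x\<in>F. x \<noteq> 0 \<longrightarrow> inverse x \<in> F)"

definition power_sums :: "nat \<Rightarrow> 'a :: semiring_1 set" where
  "power_sums k = {sum_list (map (\<lambda>x. x ^ k) xs) | xs. True}"

end

theory Submission
  imports Defs
begin

text \<open>
  \<^bold>\<open>Idea.\<close> A cyclic matrix has a cyclic vector, so it is similar to a matrix with ones on the
  superdiagonal, any prescribed diagonal of the right trace, and otherwise only entries in the first
  column. Split this matrix into two summands, which receive the superdiagonal entries alternately;
  the second one also takes the first column. If the two diagonal entries next to each superdiagonal
  one differ, and the corner entry of the second summand differs from its other diagonal entries,
  then both summands are diagonalisable, and they are \<open>k\<close>-th powers if all diagonal entries are
  \<open>k\<close>-th powers in the field. It remains to achieve the trace: each of the \<open>n - 1\<close> superdiagonal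
  positions contributes the sum of two distinct nonzero \<open>k\<close>-th powers. When there are at least three
  of these, the differences of such sums generate \<open>F\<close> additively, and \<open>ell * (p - 1)\<close> positions
  suffice. When there are only \<open>1\<close> and \<open>- 1\<close>, then \<open>ell = 1\<close> and \<open>q - 1 = d * (ell + 1)\<close>, and only
  every other position is useful, whence the stronger bound on \<open>n\<close>.
\<close>

subsection \<open>Finite fields and additive generators\<close>

text \<open>Translation by \<open>1\<close> permutes the field, so adding \<open>1\<close> to every
  summand leaves the sum of all elements unchanged. With \<open>CARD('a) = p ^ l\<close> this yields
  characteristic \<open>p\<close>.\<close>

lemma of_nat_CARD_eq_0: "of_nat CARD('a :: {field, finite}) = (0 :: 'a)"
proof -
  have "(\<Sum>x\<in>(UNIV :: 'a set). x + 1) = (\<Sum>x\<in>UNIV. x)"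
    by (rule sum.reindex_bij_witness[of _ "\<lambda>x. x - 1" "\<lambda>x. x + 1"]) auto
  thus ?thesis
    by (simp add: sum.distrib)
qed

lemma power_CARD_minus_1_eq_1:
  fixes x :: "'a :: {field, finite}"
  assumes "x \<noteq> 0"
  shows "x ^ (CARD('a) - 1) = 1"
proof -
  let ?U = "UNIV - {0 :: 'a}"
  have "(\<Prod>y\<in>?U. x * y) = \<Prod>?U"
    by (rule prod.reindex_bij_witness[of _ "\<lambda>y. y / x" "\<lambda>y. x * y"]) (use assms in auto)
  hence "x ^ card ?U * \<Prod>?U = 1 * \<Prod>?U"
    by (simp add: prod.distrib)
  moreover have "\<Prod>?U \<noteq> 0"
    by (simp add: prod_zero_iff)
  ultimately have "x ^ card ?U = 1"
    by (metis mult_right_cancel)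
  thus ?thesis
    by (simp add: card_Diff_singleton)
qed

lemma card_power_eq_1_le:
  assumes "m > 0"
  shows "card {x :: 'a :: idom. x ^ m = 1} \<le> m"
proof -
  let ?p = "monom 1 m - 1 :: 'a poly"
  have "coeff ?p m = 1"
    using assms by (simp add: coeff_1)
  hence "?p \<noteq> 0"
    by (metis coeff_0 zero_neq_one)
  moreover have "degree ?p \<le> m"
    by (rule degree_diff_le) (simp_all add: degree_monom_le)
  moreover have "{x. poly ?p x = 0} = {x. x ^ m = 1}"
    by (simp add: poly_monom)
  ultimately show ?thesis
    using card_poly_roots_bound[of ?p] by simp
qed

lemma power_gcd_eq_1:
  fixes x :: "'a :: field"
  assumes "x ^ a = 1" "x ^ b = 1" 
  shows "x ^ gcd a b = 1"
proof (cases "a = 0")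
  case False
  then obtain u v where "a * u = b * v + gcd a b"
    using bezout_nat by blast
  hence "x ^ (a * u) = x ^ (b * v) * x ^ gcd a b"
    by (simp add: power_add)
  thus ?thesis
    using assms by (simp add: power_mult)
qed (use assms in simp)

text \<open>All nonzero elements are roots of \<open>x ^ g - 1\<close> for the gcd \<open>g\<close>,
  and counting roots forces \<open>g = CARD('a) - 1\<close>. This replaces an appeal to the
  cyclicity of the unit group.\<close>

lemma CARD_minus_1_dvd_exponent:
  fixes k :: nat
  assumes "\<forall>x :: 'a :: {field, finite}. x \<noteq> 0 \<longrightarrow> x ^ k = 1" 
  shows "CARD('a) - 1 dvd k"
proof -
  let ?g = "gcd k (CARD('a) - 1)"
  have q: "CARD('a) > 1"
    using card_mono[of UNIV "{0, 1 :: 'a}"] by simp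
  have g: "?g > 0"
    using q by simp
  have "UNIV - {0 :: 'a} \<subseteq> {x. x ^ ?g = 1}"
    using assms power_CARD_minus_1_eq_1 power_gcd_eq_1 by blast
  hence "card (UNIV - {0 :: 'a}) \<le> card {x :: 'a. x ^ ?g = 1}"
    by (intro card_mono) auto
  also have "\<dots> \<le> ?g"
    using card_power_eq_1_le[OF g] .
  finally have "CARD('a) - 1 \<le> ?g"
    by (simp add: card_Diff_singleton)
  moreover have "?g \<le> CARD('a) - 1"
    using q by (intro dvd_imp_le) auto
  ultimately show ?thesis
    by (metis gcd_dvd1 le_antisym)
qed

text \<open>Extend a maximal subgroup of \<open>p ^ r\<close> elements that are sums of \<open>r * (p - 1)\<close> members of
  \<open>D\<close>: a generator \<open>a\<close> outside it is used at most \<open>p - 1\<close> times.\<close>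

lemma sum_of_generators:
  fixes F D :: "'a :: {field, finite} set"
  assumes p: "prime p" "of_nat p = (0 :: 'a)"
    and D0: "0 \<in> D" and DF: "D \<subseteq> F"
    and F0: "0 \<in> F" and Fadd: "\<And>x y. x \<in> F \<Longrightarrow> y \<in> F \<Longrightarrow> x + y \<in> F"
    and card: "card F = p ^ ell"
    and span: "\<And>G. 0 \<in> G \<Longrightarrow> (\<And>x y. x \<in> G \<Longrightarrow> y \<in> G \<Longrightarrow> x + y \<in> G) \<Longrightarrow> D \<subseteq> G \<Longrightarrow> F \<subseteq> G"
    and I: "finite I" "card I \<ge> ell * (p - 1)"
    and t: "t \<in> F"
  shows "\<exists>x. (\<forall>i\<in>I. x i \<in> D) \<and> (\<Sum>i\<in>I. x i) = t"
proof -
  \<comment> \<open>Representations are demanded over every large enough index set, so that the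
    extension below can set some positions aside. Surplus positions are absorbed by
    \<open>0 \<in> D\<close>.\<close>
  define Q where "Q = (\<lambda>r (G :: 'a set). card G = p ^ r \<and> 0 \<in> G \<and> G \<subseteq> F \<and>
    (\<forall>x\<in>G. \<forall>y\<in>G. x + y \<in> G) \<and>
    (\<forall>I :: 'b set. \<forall>g\<in>G. finite I \<longrightarrow> r * (p - 1) \<le> card I \<longrightarrow>
       (\<exists>x. (\<forall>i\<in>I. x i \<in> D) \<and> (\<Sum>i\<in>I. x i) = g)))"
  have p1: "p > 1"
    using p(1) prime_gt_1_nat by blast
  have bound: "r \<le> ell" if "Q r G" for r G
  proof -
    have "p ^ r \<le> p ^ ell"
      using that card card_mono[of F G] by (simp add: Q_def)
    thus ?thesis
      using p1 by simp
  qed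
  have "Q 0 {0}"
    unfolding Q_def using F0 D0 by (auto intro!: exI[of _ "\<lambda>_. 0"])
  hence ex: "\<exists>r. \<exists>G. Q r G"
    by blast
  define r where "r = (GREATEST r. \<exists>G. Q r G)"
  obtain G where G: "Q r G"
    using GreatestI_ex_nat[OF ex, of ell] bound unfolding r_def by blast
  have Gmax: "r' \<le> r" if "Q r' G'" for r' G'
    unfolding r_def by (rule Greatest_le_nat[of _ _ ell]) (use that bound in blast)+
  have G0: "0 \<in> G" and GF: "G \<subseteq> F" and Gadd: "\<And>x y. x \<in> G \<Longrightarrow> y \<in> G \<Longrightarrow> x + y \<in> G"
    and Gc: "card G = p ^ r"
    and Gs: "\<And>(I :: 'b set) g. g \<in> G \<Longrightarrow> finite I \<Longrightarrow> r * (p - 1) \<le> card I \<Longrightarrow>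
       (\<exists>x. (\<forall>i\<in>I. x i \<in> D) \<and> (\<Sum>i\<in>I. x i) = g)"
    using G unfolding Q_def by auto
  have mulS: "of_nat s * x \<in> S" if "0 \<in> S" "\<And>x y. x \<in> S \<Longrightarrow> y \<in> S \<Longrightarrow> x + y \<in> S" "x \<in> S"
    for s and x :: 'a and S
    using that by (induction s) (auto simp: algebra_simps)
  have "D \<subseteq> G"
  proof (rule ccontr)
    assume "\<not> D \<subseteq> G"
    then obtain a where a: "a \<in> D" "a \<notin> G"
      by blast
    let ?f = "\<lambda>(g, s). g + of_nat s * a"
    define G' where "G' = ?f ` (G \<times> {..<p})"
    \<comment> \<open>Two different multiplicities of \<open>a\<close> would put
      \<open>(s - s') * a\<close> into \<open>G\<close>, and then \<open>a\<close> itself, since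
      \<open>s - s'\<close> is invertible modulo \<open>p\<close>. So the \<open>p\<close>
      translates of \<open>G\<close> are disjoint.\<close>
    have no: False
      if lt: "g \<in> G" "g' \<in> G" "s' < s" "s < p" "g + of_nat s * a = g' + of_nat s' * a" for g g' s s'
    proof -
      have "coprime (s - s') p"
        using p(1) that by (metis coprime_commute nat_dvd_not_less prime_imp_coprime zero_less_diff less_imp_diff_less)
      then obtain u v where uv: "(s - s') * u = p * v + 1"
        using lt(3) bezout_nat[of "s - s'" p] by auto
      \<comment> \<open>Multiplication by \<open>p - 1\<close> is negation, so closure under
        addition alone provides negatives.\<close>
      have "g + of_nat (p - 1) * g = of_nat p * g"
        using p1 by (simp add: of_nat_diff algebra_simps)
      hence "g' + of_nat (p - 1) * g = of_nat (s - s') * a"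
        using that p by (simp add: of_nat_diff algebra_simps) 
      moreover have "g' + of_nat (p - 1) * g \<in> G"
        using that mulS[of G g "p - 1"] G0 Gadd by blast
      ultimately have "of_nat u * (of_nat (s - s') * a) \<in> G"
        using mulS[of G "of_nat (s - s') * a" u] G0 Gadd by metis
      moreover have "of_nat u * (of_nat (s - s') * a) = of_nat ((s - s') * u) * a"
        by (simp add: mult_ac)
      ultimately show False
        using a(2) p(2) unfolding uv by simp
    qed
    have "inj_on ?f (G \<times> {..<p})"
    proof (rule inj_onI, clarsimp)
      fix g s g' s'
      assume *: "g \<in> G" "s < p" "g' \<in> G" "s' < p" "g + of_nat s * a = g' + of_nat s' * a"
      have "s = s'"
        using no[of g g' s' s] no[of g' g s s'] * by (metis linorder_neqE_nat)
      thus "g = g' \<and> s = s'"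
        using * by simp
    qed
    hence c: "card G' = p ^ Suc r"
      unfolding G'_def by (simp add: card_image card_cartesian_product Gc)
    have z: "0 \<in> G'"
      unfolding G'_def using G0 p1 by (force intro: image_eqI[of _ _ "(0, 0)"])
    have s: "G' \<subseteq> F"
      unfolding G'_def using GF DF a(1) mulS[of F a] F0 Fadd by (auto intro!: Fadd)
    have add: "x + y \<in> G'" if "x \<in> G'" "y \<in> G'" for x y
    proof -
      from that obtain g s g' s' where *: "g \<in> G" "g' \<in> G" "x = g + of_nat s * a" "y = g' + of_nat s' * a"
        unfolding G'_def by auto
      have "of_nat (s + s') = (of_nat ((s + s') mod p) :: 'a)"
      proof -
        have "of_nat (s + s') = (of_nat (p * ((s + s') div p) + (s + s') mod p) :: 'a)"
          by simp
        thus ?thesis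
          unfolding of_nat_add of_nat_mult p(2) by simp
      qed
      moreover have "x + y = g + g' + of_nat (s + s') * a"
        using * by (simp add: algebra_simps)
      ultimately have "x + y = ?f (g + g', (s + s') mod p)"
        by simp
      thus ?thesis
        unfolding G'_def using * Gadd p1 by (intro image_eqI[of _ _ "(g + g', (s + s') mod p)"]) auto
    qed
    have "\<exists>x. (\<forall>i\<in>I. x i \<in> D) \<and> (\<Sum>i\<in>I. x i) = h"
      if hI: "h \<in> G'" "finite I" "Suc r * (p - 1) \<le> card I" for I :: "'b set" and h
    proof -
      from hI(1) obtain g s where gs: "g \<in> G" "s < p" "h = g + of_nat s * a"
        unfolding G'_def by auto
      \<comment> \<open>At most \<open>p - 1\<close> positions take the value \<open>a\<close>; at
        least \<open>r * (p - 1)\<close> remain to represent \<open>g\<close>.\<close>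
      have "s \<le> card I"
        using gs hI(3) by simp
      then obtain J where J: "J \<subseteq> I" "card J = s" "finite J"
        by (metis obtain_subset_with_card_n)
      have "r * (p - 1) \<le> card (I - J)"
        using gs hI J by (simp add: card_Diff_subset)
      then obtain x where x: "\<forall>i\<in>I - J. x i \<in> D" "(\<Sum>i\<in>I - J. x i) = g"
        using Gs[OF gs(1), of "I - J"] hI(2) by auto
      let ?x = "\<lambda>i. if i \<in> J then a else x i"
      have "(\<Sum>i\<in>I. ?x i) = (\<Sum>i\<in>I - J. ?x i) + (\<Sum>i\<in>J. ?x i)"
        using J hI(2) by (intro sum.subset_diff) auto
      also have "\<dots> = h"
        using gs x J by simp
      finally show ?thesis
        using x(1) a(1) by (intro exI[of _ ?x]) auto
    qed
    hence "Q (Suc r) G'"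
      unfolding Q_def using c z s add by blast
    thus False
      using Gmax by fastforce
  qed
  hence "F \<subseteq> G"
    using span G0 Gadd by blast
  moreover have "r * (p - 1) \<le> card I"
    using bound[OF G] I(2) by (meson le_trans mult_le_mono1)
  ultimately show ?thesis
    using Gs I(1) t by blast
qed

subsection \<open>The group of nonzero powers\<close>

text \<open>The subgroup of \<open>k\<close>-th powers in the unit group of the field.\<close>

definition nonzero_powers :: "nat \<Rightarrow> 'a :: field set" where
  "nonzero_powers k = (\<lambda>x. x ^ k) ` (- {0})"

lemma power_in_nonzero_powers: "x \<noteq> 0 \<Longrightarrow> x ^ k \<in> nonzero_powers k"
  by (simp add: nonzero_powers_def)

lemma one_in_nonzero_powers: "1 \<in> nonzero_powers k"
  using power_in_nonzero_powers[of 1 k] by simp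

lemma nonzero_powers_nonzero: "x \<in> nonzero_powers k \<Longrightarrow> x \<noteq> 0"
  by (auto simp: nonzero_powers_def)

lemma nonzero_powers_mult:
  "x \<in> nonzero_powers k \<Longrightarrow> y \<in> nonzero_powers k \<Longrightarrow> x * y \<in> nonzero_powers k"
  unfolding nonzero_powers_def by (auto simp flip: power_mult_distrib)

lemma nonzero_powers_divide:
  "x \<in> nonzero_powers k \<Longrightarrow> y \<in> nonzero_powers k \<Longrightarrow> x / y \<in> nonzero_powers k"
  unfolding nonzero_powers_def by (auto simp flip: power_divide)

text \<open>An induction principle using additive closure only; since \<open>k \<ge> 1\<close>, the
  power of \<open>0\<close> is \<open>0\<close> and adds no generator.\<close>

lemma power_sums_subset:
  fixes G :: "'a :: field set"
  assumes "k \<ge> 1" "0 \<in> G" "\<And>x y. x \<in> G \<Longrightarrow> y \<in> G \<Longrightarrow> x + y \<in> G" "nonzero_powers k \<subseteq> G"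
  shows "power_sums k \<subseteq> G"
proof -
  have pow: "x ^ k \<in> G" for x :: 'a
    using assms power_in_nonzero_powers[of x k] by (cases "x = 0") (auto simp: power_0_left)
  have "sum_list (map (\<lambda>x. x ^ k) xs) \<in> G" for xs :: "'a list"
    by (induction xs) (auto intro: assms pow)
  thus ?thesis
    by (auto simp: power_sums_def)
qed

lemma nonzero_powers_subset_power_sums: "nonzero_powers k \<subseteq> power_sums k"
proof
  fix x :: 'a
  assume "x \<in> nonzero_powers k"
  then obtain y where "x = sum_list (map (\<lambda>x. x ^ k) [y])"
    by (auto simp: nonzero_powers_def)
  thus "x \<in> power_sums k"
    unfolding power_sums_def by blast
qed

text \<open>Multiplication by \<open>h\<close> permutes the nonzero powers and so fixes their sum,
  while \<open>h - 1\<close> is invertible.\<close>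

lemma sum_nonzero_powers_eq_0:
  assumes "(h :: 'a :: field) \<in> nonzero_powers k" "h \<noteq> 1"
  shows "\<Sum>(nonzero_powers k :: 'a set) = 0"
proof -
  let ?H = "nonzero_powers k :: 'a set"
  have "(\<Sum>x\<in>?H. h * x) = \<Sum>?H"
    by (rule sum.reindex_bij_witness[of _ "\<lambda>x. x / h" "\<lambda>x. h * x"])
      (use assms(1) nonzero_powers_nonzero in \<open>auto intro: nonzero_powers_mult nonzero_powers_divide\<close>)
  hence "h * \<Sum>?H = \<Sum>?H"
    by (simp add: sum_distrib_left)
  hence "(h - 1) * \<Sum>?H = 0"
    by (simp add: left_diff_distrib)
  thus ?thesis
    using assms(2) by simp
qed

text \<open>The nonzero \<open>k\<close>-th powers sum to zero, so one of them is redundant as a generator over the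
  prime field.\<close>

lemma exponent_less_card_nonzero_powers:
  fixes h :: "'a :: {field, finite}"
  assumes p: "prime p" "of_nat p = (0 :: 'a)" and k: "k \<ge> 1"
    and h: "h \<in> nonzero_powers k" "h \<noteq> 1"
    and card: "card (power_sums k :: 'a set) = p ^ ell"
  shows "ell < card (nonzero_powers k :: 'a set)"
proof -
  let ?H = "nonzero_powers k :: 'a set"
  define K where "K = ?H - {1}"
  define G where "G = range (\<lambda>s :: 'a \<Rightarrow> nat. \<Sum>y\<in>K. of_nat (s y) * y)"
  have p1: "p > 1"
    using p(1) prime_gt_1_nat by blast
  have "0 \<in> G"
    unfolding G_def by (rule range_eqI[of _ _ "\<lambda>_. 0"]) simp
  moreover have "x + y \<in> G" if xy: "x \<in> G" "y \<in> G" for x y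
  proof -
    from xy obtain s s' where
      "x = (\<Sum>y\<in>K. of_nat (s y) * y)" "y = (\<Sum>y\<in>K. of_nat (s' y) * y)"
      unfolding G_def by auto
    hence "x + y = (\<Sum>y\<in>K. of_nat (s y + s' y) * y)"
      by (simp add: sum.distrib algebra_simps)
    thus ?thesis
      unfolding G_def by (intro range_eqI)
  qed
  moreover have "?H \<subseteq> G"
  proof
    fix x assume x: "x \<in> ?H"
    show "x \<in> G"
    proof (cases "x = 1")
      case True
      have "\<Sum>?H = 1 + \<Sum>K"
        unfolding K_def using one_in_nonzero_powers by (subst sum.remove[of _ 1]) auto
      \<comment> \<open>The vanishing sum expresses \<open>1\<close> by the other powers. The
        coefficient \<open>- 1\<close> becomes \<open>p - 1\<close>, because coefficients in
        \<open>G\<close> are natural numbers.\<close>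
      hence "1 = - \<Sum>K"
        using sum_nonzero_powers_eq_0[OF h] by (simp add: eq_neg_iff_add_eq_0)
      also have "\<dots> = (\<Sum>y\<in>K. of_nat (p - 1) * y)"
        using p1 p(2) by (simp add: of_nat_diff sum_negf)
      finally show ?thesis
        unfolding G_def True by (intro range_eqI)
    next
      case False
      hence "x = (\<Sum>y\<in>K. of_nat (if y = x then 1 else 0) * y)"
        using x by (simp add: K_def if_distrib if_distribR cong: if_cong)
      thus ?thesis
        unfolding G_def by (intro range_eqI)
    qed
  qed
  ultimately have "power_sums k \<subseteq> G"
    using k by (intro power_sums_subset)
  \<comment> \<open>Coefficients matter only modulo \<open>p\<close>, which leaves at most
    \<open>p ^ card K\<close> elements.\<close>
  also have "G \<subseteq> (\<lambda>s. \<Sum>y\<in>K. of_nat (s y) * y) ` (K \<rightarrow>\<^sub>E {..<p})"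
  proof
    fix x assume "x \<in> G"
    then obtain s where x: "x = (\<Sum>y\<in>K. of_nat (s y) * y)"
      unfolding G_def by blast
    have "of_nat m = (of_nat (m mod p) :: 'a)" for m
    proof -
      have "of_nat m = (of_nat (p * (m div p) + m mod p) :: 'a)"
        by simp
      thus ?thesis
        unfolding of_nat_add of_nat_mult p(2) by simp
    qed
    hence "x = (\<Sum>y\<in>K. of_nat (restrict (\<lambda>y. s y mod p) K y) * y)"
      unfolding x by (intro sum.cong) auto
    thus "x \<in> (\<lambda>s. \<Sum>y\<in>K. of_nat (s y) * y) ` (K \<rightarrow>\<^sub>E {..<p})"
      using p1 by (intro image_eqI[of _ _ "restrict (\<lambda>y. s y mod p) K"]) auto
  qed
  finally have "p ^ ell \<le> card ((\<lambda>s. \<Sum>y\<in>K. of_nat (s y) * y) ` (K \<rightarrow>\<^sub>E {..<p}))"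
    unfolding card[symmetric] by (intro card_mono) auto
  also have "\<dots> \<le> card (K \<rightarrow>\<^sub>E {..<p})"
    by (intro card_image_le finite_PiE) auto
  also have "\<dots> = p ^ card K"
    by (simp add: card_PiE)
  finally have "ell \<le> card K"
    using p1 by simp
  also have "card K < card ?H"
    unfolding K_def using one_in_nonzero_powers by (intro card_Diff1_less) auto
  finally show ?thesis .
qed

text \<open>Write \<open>CARD('a) - 1 = d * m\<close> with \<open>d\<close> the gcd. Then
  \<open>k * m\<close> is a multiple of \<open>CARD('a) - 1\<close>, so every nonzero
  \<open>k\<close>-th power is one of the at most \<open>m\<close> roots of
  \<open>x ^ m - 1\<close>.\<close>

lemma card_nonzero_powers_le:
  assumes "k \<ge> 1"
  shows "gcd k (CARD('a) - 1) * card (nonzero_powers k :: 'a set) \<le> CARD('a :: {field, finite}) - 1"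
proof -
  let ?q = "CARD('a) - 1"
  let ?d = "gcd k ?q"
  have q: "?q > 0"
    using card_mono[of UNIV "{0, 1 :: 'a}"] by simp
  obtain m where m: "?q = ?d * m"
    by (metis dvdE gcd_dvd2)
  obtain c where c: "k = ?d * c"
    by (metis dvdE gcd_dvd1)
  have "m > 0"
    using q m by (metis gr0I mult_0_right)
  have "nonzero_powers k \<subseteq> {x :: 'a. x ^ m = 1}"
  proof
    fix y :: 'a
    assume "y \<in> nonzero_powers k"
    then obtain x where x: "x \<noteq> 0" "y = x ^ k"
      by (auto simp: nonzero_powers_def)
    have "y ^ m = x ^ (?d * c * m)"
      using c x(2) by (metis power_mult)
    also have "?d * c * m = ?q * c"
      by (metis m mult.assoc mult.commute)
    also have "x ^ (?q * c) = 1"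
      unfolding power_mult power_CARD_minus_1_eq_1[OF x(1)] by simp
    finally show "y \<in> {x. x ^ m = 1}"
      by simp
  qed
  hence "card (nonzero_powers k :: 'a set) \<le> card {x :: 'a. x ^ m = 1}"
    by (intro card_mono) auto
  also have "\<dots> \<le> m"
    using card_power_eq_1_le[OF \<open>m > 0\<close>] .
  finally have "?d * card (nonzero_powers k :: 'a set) \<le> ?d * m"
    by simp
  thus ?thesis
    by (metis m)
qed

section \<open>Subfield elements as sums of pairs of distinct powers\<close>

lemma is_subfieldD:
  assumes "is_subfield F"
  shows "0 \<in> F" "1 \<in> F" "x \<in> F \<Longrightarrow> y \<in> F \<Longrightarrow> x + y \<in> F" "x \<in> F \<Longrightarrow> y \<in> F \<Longrightarrow> x * y \<in> F"
    "x \<in> F \<Longrightarrow> y \<in> F \<Longrightarrow> x - y \<in> F" "x \<in> F \<Longrightarrow> y \<in> F \<Longrightarrow> x / y \<in> F"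
proof -
  show "x \<in> F \<Longrightarrow> y \<in> F \<Longrightarrow> x - y \<in> F"
    using assms unfolding is_subfield_def by (metis add_uminus_conv_diff)
  show "x \<in> F \<Longrightarrow> y \<in> F \<Longrightarrow> x / y \<in> F"
    using assms unfolding is_subfield_def by (metis divide_inverse inverse_zero)
qed (use assms in \<open>auto simp: is_subfield_def\<close>)

text \<open>Subtracting the fixed pair sum \<open>1 + h\<close> from every pair sum gives a
  generating set containing \<open>0\<close>, to which \<open>sum_of_generators\<close> applies with
  the target shifted by \<open>N\<close> copies of \<open>1 + h\<close>.\<close>

lemma sum_of_distinct_pairs:
  fixes F :: "'a :: {field, finite} set"
  assumes p: "prime p" "of_nat p = (0 :: 'a)" and k: "k \<ge> 1"
    and F: "is_subfield F" "card F = p ^ ell" "power_sums k = F"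
    and H: "card (nonzero_powers k :: 'a set) \<ge> 3"
    and N: "N \<ge> ell * (p - 1)" and t: "t \<in> F"
  shows "\<exists>u v. (\<forall>i<N. u i \<in> nonzero_powers k \<and> v i \<in> nonzero_powers k \<and> u i \<noteq> v i) \<and>
    (\<Sum>i<N. u i + v i) = t"
proof -
  let ?H = "nonzero_powers k :: 'a set"
  note FD = is_subfieldD[OF F(1)]
  have HF: "?H \<subseteq> F"
    using nonzero_powers_subset_power_sums F(3) by blast
  have third: "\<exists>z\<in>?H. z \<noteq> x \<and> z \<noteq> y" for x y
  proof (rule ccontr)
    assume "\<not> ?thesis"
    hence "?H \<subseteq> {x, y}"
      by blast
    hence "card ?H \<le> card {x, y}"
      by (intro card_mono) auto
    also have "\<dots> \<le> 2"
      by (simp add: card_insert_if)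
    finally show False
      using H by simp
  qed
  obtain h where h: "h \<in> ?H" "h \<noteq> 1"
    using third by blast
  define D where "D = {x + y - (1 + h) | x y. x \<in> ?H \<and> y \<in> ?H \<and> x \<noteq> y}"
  have "0 = 1 + h - (1 + h)"
    by simp
  hence D0: "0 \<in> D"
    unfolding D_def using h one_in_nonzero_powers[of k] by blast
  have DF: "D \<subseteq> F"
    unfolding D_def using HF h by (auto intro!: FD)
  have "F \<subseteq> G" if G0: "0 \<in> G" and Gadd: "\<And>x y. x \<in> G \<Longrightarrow> y \<in> G \<Longrightarrow> x + y \<in> G" and "D \<subseteq> G" for G
  proof -
    have mul: "of_nat s * x \<in> G" if "x \<in> G" for s x
      using that G0 Gadd by (induction s) (auto simp: algebra_simps)
    have minus: "x - y \<in> G" if "x \<in> G" "y \<in> G" for x y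
    proof -
      have "of_nat (p - 1) * y = - y"
        using p prime_gt_0_nat[OF p(1)] by (simp add: of_nat_diff)
      thus ?thesis
        using Gadd[OF that(1) mul[OF that(2), of "p - 1"]] by simp
    qed
    \<comment> \<open>A third power \<open>y\<close> completes both \<open>x\<close> and
      \<open>z\<close> to pairs of distinct powers; the common terms cancel.\<close>
    have diff: "x - z \<in> G" if "x \<in> ?H" "z \<in> ?H" for x z
    proof -
      obtain y where "y \<in> ?H" "y \<noteq> x" "y \<noteq> z"
        using third by blast
      hence "x + y - (1 + h) \<in> G" "z + y - (1 + h) \<in> G"
        using that \<open>D \<subseteq> G\<close> unfolding D_def by blast+
      from minus[OF this] show ?thesis
        by simp
    qed
    \<comment> \<open>The differences \<open>h * x - x\<close> of powers put
      \<open>(h - 1) * x\<close> into \<open>G\<close> for every sum of powers \<open>x\<close>,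
      that is for all of \<open>F\<close>; and multiplication by \<open>h - 1\<close> maps
      \<open>F\<close> onto itself.\<close>
    have "power_sums k \<subseteq> {x. (h - 1) * x \<in> G}"
    proof (rule power_sums_subset[OF k])
      show "?H \<subseteq> {x. (h - 1) * x \<in> G}"
        using diff[OF nonzero_powers_mult[OF h(1)]] by (auto simp: algebra_simps)
      show "x + y \<in> {x. (h - 1) * x \<in> G}"
        if "x \<in> {x. (h - 1) * x \<in> G}" "y \<in> {x. (h - 1) * x \<in> G}" for x y
        using that Gadd[of "(h - 1) * x" "(h - 1) * y"] by (simp add: distrib_left)
    qed (use G0 in simp)
    hence *: "(h - 1) * x \<in> G" if "x \<in> F" for x
      using that F(3) by blast
    show ?thesis
    proof
      fix x assume "x \<in> F"
      hence "x / (h - 1) \<in> F"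
        using h HF by (auto intro!: FD)
      from *[OF this] show "x \<in> G"
        using h by simp
    qed
  qed
  moreover have "t - of_nat N * (1 + h) \<in> F"
  proof -
    have "of_nat N \<in> F"
      by (induction N) (auto intro: FD)
    moreover have "1 + h \<in> F"
      using h HF by (auto intro: FD)
    ultimately show ?thesis
      using t by (intro FD(4) FD(5))
  qed
  ultimately obtain x where x: "\<forall>i\<in>{..<N}. x i \<in> D" "(\<Sum>i<N. x i) = t - of_nat N * (1 + h)"
    using sum_of_generators[OF p D0 DF FD(1) FD(3) F(2), of "{..<N}"] N
    by (metis (no_types, lifting) card_lessThan finite_lessThan)
  from x(1) have "\<forall>i\<in>{..<N}. \<exists>uv. fst uv \<in> ?H \<and> snd uv \<in> ?H \<and> fst uv \<noteq> snd uv \<and> x i = fst uv + snd uv - (1 + h)"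
    unfolding D_def by fastforce
  from bchoice[OF this] obtain uv where uv: "\<And>i. i < N \<Longrightarrow>
    fst (uv i) \<in> ?H \<and> snd (uv i) \<in> ?H \<and> fst (uv i) \<noteq> snd (uv i) \<and> x i = fst (uv i) + snd (uv i) - (1 + h)"
    by auto
  have "(\<Sum>i<N. fst (uv i) + snd (uv i)) = (\<Sum>i<N. x i + (1 + h))"
    by (intro sum.cong) (use uv in auto)
  also have "\<dots> = t"
    using x(2) by (simp add: sum.distrib algebra_simps)
  finally show ?thesis
    using uv by (intro exI[of _ "fst \<circ> uv"] exI[of _ "snd \<circ> uv"]) auto
qed

lemma card_even_lessThan: "card {i. i < N \<and> even i} = (N + 1) div 2" for N :: nat
proof (induction N)
  case (Suc N)
  have "{i. i < Suc N \<and> even i} = (if even N then insert N else id) {i. i < N \<and> even i}"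
    by (auto simp: less_Suc_eq)
  thus ?case
    using Suc by auto
qed simp

text \<open>With only the two \<open>k\<close>-th powers \<open>1\<close> and \<open>- 1\<close> besides \<open>0\<close>, the odd positions are forced
  to cancel and only the even ones, where \<open>0\<close> is allowed, contribute.\<close>

lemma sum_of_sign_pairs:
  fixes F :: "'a :: {field, finite} set"
  assumes p: "prime p" "of_nat p = (0 :: 'a)" and k: "k \<ge> 1"
    and F: "is_subfield F" "card F = p ^ ell" "power_sums k = F"
    and H: "nonzero_powers k = {1, - 1 :: 'a}" "(1 :: 'a) \<noteq> - 1"
    and N: "(N + 1) div 2 \<ge> ell * (p - 1)" and t: "t \<in> F"
  shows "\<exists>u v :: nat \<Rightarrow> 'a. (\<forall>i<N. u i \<noteq> v i \<and> u i \<in> insert 0 (nonzero_powers k) \<and>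
      v i \<in> insert 0 (nonzero_powers k) \<and> (odd i \<longrightarrow> u i \<noteq> 0 \<and> v i \<noteq> 0)) \<and>
    (\<Sum>i<N. u i + v i) = t"
proof -
  note FD = is_subfieldD[OF F(1)]
  let ?I = "{i. i < N \<and> even i}"
  have "F \<subseteq> G" if G0: "0 \<in> G" and Gadd: "\<And>x y. x \<in> G \<Longrightarrow> y \<in> G \<Longrightarrow> x + y \<in> G" and "{0, 1} \<subseteq> G" for G
  proof -
    have "of_nat s \<in> G" for s
      using G0 Gadd \<open>{0, 1} \<subseteq> G\<close> by (induction s) auto
    moreover have "of_nat (p - 1) = (- 1 :: 'a)"
      using p prime_gt_0_nat[OF p(1)] by (simp add: of_nat_diff)
    ultimately have "- 1 \<in> G"
      by metis
    hence "nonzero_powers k \<subseteq> G"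
      using \<open>{0, 1} \<subseteq> G\<close> by (simp add: H(1))
    from power_sums_subset[OF k G0 Gadd this] show ?thesis
      by (simp add: F(3))
  qed
  then obtain x where x: "\<forall>i\<in>?I. x i \<in> {0, 1}" "(\<Sum>i\<in>?I. x i) = t"
    using sum_of_generators[OF p, of "{0, 1}" F, OF _ _ FD(1) FD(3) F(2), of ?I t] t N FD
    by (auto simp: card_even_lessThan)
  \<comment> \<open>With \<open>u i = 1\<close> throughout, an even position contributes
    \<open>x i\<close>, which is \<open>0\<close> or \<open>1\<close>, and an odd one contributes
    \<open>0\<close>.\<close>
  define v where "v = (\<lambda>i. if even i then x i - 1 else - 1)"
  have "(\<Sum>i<N. 1 + v i) = (\<Sum>i<N. if even i then x i else 0)"
    by (intro sum.cong) (auto simp: v_def)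
  also have "\<dots> = t"
    using x(2) by (simp flip: sum.inter_filter)
  finally have sum: "(\<Sum>i<N. 1 + v i) = t" .
  have v: "v i \<in> {0, - 1}" "odd i \<Longrightarrow> v i = - 1" if "i < N" for i
    using x(1) that by (auto simp: v_def)
  have "1 \<noteq> v i \<and> (1 :: 'a) \<in> insert 0 (nonzero_powers k) \<and> v i \<in> insert 0 (nonzero_powers k) \<and>
    (odd i \<longrightarrow> (1 :: 'a) \<noteq> 0 \<and> v i \<noteq> 0)" if "i < N" for i
    using v[OF that] H(2) unfolding H(1) by auto
  thus ?thesis
    using sum by (intro exI[of _ "\<lambda>_. 1"] exI[of _ v]) simp
qed

text \<open>In a group \<open>{1, h}\<close> the square of \<open>h\<close> is \<open>1\<close>, so
  \<open>h = - 1\<close>. Then \<open>x ^ (2 * k) = 1\<close> for all nonzero \<open>x\<close>, so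
  \<open>CARD('a) - 1\<close> divides \<open>2 * k\<close> and hence twice the gcd.\<close>

lemma nonzero_powers_eq_signs:
  fixes k :: nat
  assumes "card (nonzero_powers k :: 'a :: {field, finite} set) = 2"
  shows "nonzero_powers k = {1, - 1 :: 'a}" "(1 :: 'a) \<noteq> - 1"
    "CARD('a) - 1 dvd 2 * gcd k (CARD('a) - 1)"
proof -
  let ?H = "nonzero_powers k :: 'a set"
  obtain h where h: "?H = {1, h}" "h \<noteq> 1"
    using assms one_in_nonzero_powers[of k] by (metis card_2_iff doubleton_eq_iff insertE singletonD)
  have "h * h \<in> ?H" "h \<noteq> 0"
    using h nonzero_powers_mult nonzero_powers_nonzero by blast+
  hence "h * h = 1"
    using h by auto
  hence "h = - 1"
    using h by (metis square_eq_1_iff)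
  thus "?H = {1, - 1}" "(1 :: 'a) \<noteq> - 1"
    using h by auto
  have "x ^ (2 * k) = 1" if "x \<noteq> 0" for x :: 'a
  proof -
    have "x ^ k \<in> {1, - 1}"
      using power_in_nonzero_powers[OF that, of k] h \<open>h = - 1\<close> by simp
    hence "(x ^ k) ^ 2 = 1"
      by auto
    thus ?thesis
      by (metis power_mult mult.commute)
  qed
  hence "CARD('a) - 1 dvd 2 * k"
    by (intro CARD_minus_1_dvd_exponent) auto
  thus "CARD('a) - 1 dvd 2 * gcd k (CARD('a) - 1)"
    by (metis dvd_triv_right gcd_greatest gcd_mult_distrib_nat)
qed

subsection \<open>Cyclic vectors\<close>

text \<open>The vector \<open>f(A) v\<close>, evaluated by Horner's scheme: vectors become a module
  over the polynomials without forming matrix powers.\<close>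

definition poly_act :: "'a :: field mat \<Rightarrow> 'a vec \<Rightarrow> 'a poly \<Rightarrow> 'a vec" where
  "poly_act A v f = fold_coeffs (\<lambda>a w. a \<cdot>\<^sub>v v + A *\<^sub>v w) f (0\<^sub>v (dim_row A))"

lemma poly_act_0 [simp]: "poly_act A v 0 = 0\<^sub>v (dim_row A)"
  by (simp add: poly_act_def)

lemma poly_act_pCons:
  assumes "A \<in> carrier_mat n n" "v \<in> carrier_vec n"
  shows "poly_act A v (pCons a f) = a \<cdot>\<^sub>v v + A *\<^sub>v poly_act A v f"
proof (cases "a = 0 \<and> f = 0")
  case True
  thus ?thesis
    using assms by auto
qed (auto simp: poly_act_def)

lemma poly_act_carrier [simp]:
  assumes "A \<in> carrier_mat n n" "v \<in> carrier_vec n"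
  shows "poly_act A v f \<in> carrier_vec n"
  by (induction f) (use assms in \<open>auto simp: poly_act_pCons\<close>)

lemma mult_mat_zero_vec [simp]: "A \<in> carrier_mat m n \<Longrightarrow> A *\<^sub>v 0\<^sub>v n = 0\<^sub>v m"
  by auto

lemma poly_act_add:
  assumes "A \<in> carrier_mat n n" "v \<in> carrier_vec n"
  shows "poly_act A v (f + g) = poly_act A v f + poly_act A v g"
proof (induction f g rule: poly_induct2)
  case 0
  show ?case using assms by auto
next
  case (pCons a f b g)
  have "A *\<^sub>v (poly_act A v f + poly_act A v g) = A *\<^sub>v poly_act A v f + A *\<^sub>v poly_act A v g"
    using assms by (intro mult_add_distrib_mat_vec) auto
  thus ?case
    using assms pCons by (auto simp: poly_act_pCons[OF assms] add_smult_distrib_vec intro!: eq_vecI)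
qed

lemma poly_act_pCons_0:
  assumes "A \<in> carrier_mat n n" "v \<in> carrier_vec n"
  shows "poly_act A v (pCons 0 f) = A *\<^sub>v poly_act A v f"
  using assms by (auto simp: poly_act_pCons[OF assms])

lemma poly_act_smult:
  assumes "A \<in> carrier_mat n n" "v \<in> carrier_vec n"
  shows "poly_act A v (Polynomial.smult c f) = c \<cdot>\<^sub>v poly_act A v f"
proof (induction f)
  case (pCons a f)
  have "A *\<^sub>v (c \<cdot>\<^sub>v poly_act A v f) = c \<cdot>\<^sub>v (A *\<^sub>v poly_act A v f)"
    using assms by (intro mult_mat_vec) auto
  thus ?case
    using assms pCons
    by (auto simp: poly_act_pCons[OF assms] smult_add_distrib_vec[of _ n] smult_smult_assoc)
qed (use assms in auto)

lemma poly_act_mult: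
  assumes "A \<in> carrier_mat n n" "v \<in> carrier_vec n"
  shows "poly_act A v (f * g) = poly_act A (poly_act A v g) f"
proof (induction f)
  case (pCons a f)
  have "poly_act A v (pCons a f * g) = poly_act A v (Polynomial.smult a g) + poly_act A v (pCons 0 (f * g))"
    using poly_act_add[OF assms] by simp
  also have "\<dots> = a \<cdot>\<^sub>v poly_act A v g + A *\<^sub>v poly_act A (poly_act A v g) f"
    using assms pCons by (simp add: poly_act_smult[OF assms] poly_act_pCons_0[OF assms])
  also have "\<dots> = poly_act A (poly_act A v g) (pCons a f)"
    using assms by (simp add: poly_act_pCons[of A n])
  finally show ?case .
qed simp

lemma poly_act_zero_vec:
  assumes "A \<in> carrier_mat n n"
  shows "poly_act A (0\<^sub>v n) f = 0\<^sub>v n"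
  by (induction f) (use assms in \<open>auto simp: poly_act_pCons[OF assms]\<close>)

lemma poly_act_add_vec:
  assumes "A \<in> carrier_mat n n" "v \<in> carrier_vec n" "w \<in> carrier_vec n"
  shows "poly_act A (v + w) f = poly_act A v f + poly_act A w f"
proof (induction f)
  case (pCons a f)
  have "A *\<^sub>v (poly_act A v f + poly_act A w f) = A *\<^sub>v poly_act A v f + A *\<^sub>v poly_act A w f"
    using assms by (intro mult_add_distrib_mat_vec) auto
  thus ?case
    using assms pCons
    by (auto simp: poly_act_pCons[of A n] smult_add_distrib_vec[of _ n] intro!: eq_vecI)
qed (use assms in auto)

text \<open>This is \<open>x * f = (x - a) * f + a * f\<close>. For products of linear factors it
  produces the superdiagonal ones and the prescribed diagonal.\<close>

lemma poly_act_linear_factor: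
  assumes "A \<in> carrier_mat n n" "v \<in> carrier_vec n"
  shows "A *\<^sub>v poly_act A v f = poly_act A v ([:- a, 1:] * f) + a \<cdot>\<^sub>v poly_act A v f"
proof -
  have "pCons 0 f = [:- a, 1:] * f + Polynomial.smult a f"
    by simp
  moreover have "poly_act A v (pCons 0 f) = A *\<^sub>v poly_act A v f"
    using poly_act_pCons_0[OF assms] .
  ultimately show ?thesis
    by (metis poly_act_add[OF assms] poly_act_smult[OF assms])
qed

text \<open>The bridge from the entrywise evaluation used for minimal polynomials to the action on
  vectors.\<close>

lemma poly_at_mat_index:
  assumes A: "A \<in> carrier_mat n n" and ij: "i < n" "j < n"
  shows "poly_at_mat f A $$ (i, j) = poly_act A (unit_vec n j) f $ i"
proof -
  have "(\<Sum>m\<le>degree f. coeff f m * (A ^\<^sub>m m) $$ (i, j)) = poly_act A (unit_vec n j) f $ i"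
    using ij(1)
  proof (induction f arbitrary: i)
    case (pCons a f)
    let ?w = "poly_act A (unit_vec n j) f"
    have w: "?w \<in> carrier_vec n"
      using A by auto
    have pow: "(A ^\<^sub>m Suc m) $$ (i, j) = (\<Sum>r<n. A $$ (i, r) * (A ^\<^sub>m m) $$ (r, j))" for m
    proof -
      have "A ^\<^sub>m Suc m = A * A ^\<^sub>m m"
        using A by (induction m) (simp_all add: assoc_mult_mat[of _ n n _ n _ n])
      thus ?thesis
        using A pCons.prems ij by (simp add: scalar_prod_def lessThan_atLeast0)
    qed
    \<comment> \<open>For \<open>f = 0\<close> the degree does not grow; the range is widened
      uniformly, as the extra coefficient vanishes.\<close>
    have "(\<Sum>m\<le>degree (pCons a f). coeff (pCons a f) m * (A ^\<^sub>m m) $$ (i, j)) =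
      (\<Sum>m\<le>Suc (degree f). coeff (pCons a f) m * (A ^\<^sub>m m) $$ (i, j))"
      by (intro sum.mono_neutral_left) (auto simp: degree_pCons_eq_if coeff_pCons split: nat.splits)
    also have "\<dots> = a * 1\<^sub>m n $$ (i, j) + (\<Sum>m\<le>degree f. coeff f m * (A ^\<^sub>m Suc m) $$ (i, j))"
      using A by (subst sum.atMost_Suc_shift) (simp del: pow_mat.simps(2))
    also have "(\<Sum>m\<le>degree f. coeff f m * (A ^\<^sub>m Suc m) $$ (i, j)) =
      (\<Sum>r<n. A $$ (i, r) * (\<Sum>m\<le>degree f. coeff f m * (A ^\<^sub>m m) $$ (r, j)))"
      unfolding pow sum_distrib_left by (subst sum.swap) (simp add: mult_ac)
    also have "\<dots> = (\<Sum>r<n. A $$ (i, r) * ?w $ r)"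
      using pCons.IH by (intro sum.cong) auto
    also have "\<dots> = (A *\<^sub>v ?w) $ i"
      using A pCons.prems by (simp add: scalar_prod_def lessThan_atLeast0 carrier_vecD[OF w])
    finally show ?case
      using A w pCons.prems ij by (simp add: poly_act_pCons[of A n] unit_vec_def)
  qed (use A in simp)
  thus ?thesis
    using A ij by (simp add: poly_at_mat_def)
qed

lemma poly_at_mat_eq_0_iff:
  assumes A: "A \<in> carrier_mat n n"
  shows "poly_at_mat f A = 0\<^sub>m n n \<longleftrightarrow> (\<forall>v\<in>carrier_vec n. poly_act A v f = 0\<^sub>v n)"
proof
  assume "\<forall>v\<in>carrier_vec n. poly_act A v f = 0\<^sub>v n"
  thus "poly_at_mat f A = 0\<^sub>m n n"
    using A by (intro eq_matI) (auto simp: poly_at_mat_index[OF A], auto simp: poly_at_mat_def)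
next
  assume *: "poly_at_mat f A = 0\<^sub>m n n"
  have unit: "poly_act A (unit_vec n j) f = 0\<^sub>v n" if "j < n" for j
  proof (rule eq_vecI)
    fix i assume "i < dim_vec (0\<^sub>v n :: 'a vec)"
    thus "poly_act A (unit_vec n j) f $ i = 0\<^sub>v n $ i"
      using * that poly_at_mat_index[OF A, of i j f] by simp
  qed (use A in \<open>auto intro: carrier_vecD\<close>)
  \<comment> \<open>Scaling is the action of the constant polynomial \<open>[:c:]\<close>, and
    polynomials commute.\<close>
  have scale: "poly_act A (c \<cdot>\<^sub>v v) f = c \<cdot>\<^sub>v poly_act A v f" if "v \<in> carrier_vec n" for c v
    using poly_act_mult[OF A that, of f "[:c:]"] poly_act_smult[OF A that, of c f] that A
    by (simp add: poly_act_pCons[OF A that])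
  show "\<forall>v\<in>carrier_vec n. poly_act A v f = 0\<^sub>v n"
  proof
    fix v :: "'a vec" assume v: "v \<in> carrier_vec n"
    \<comment> \<open>\<open>v\<close> is assembled from unit vectors, one coordinate at a
      time.\<close>
    have "poly_act A (vec n (\<lambda>i. if i < m then v $ i else 0)) f = 0\<^sub>v n" if "m \<le> n" for m
      using that
    proof (induction m)
      case 0
      have "vec n (\<lambda>i. if i < 0 then v $ i else 0) = 0\<^sub>v n"
        by auto
      thus ?case
        using poly_act_zero_vec[OF A] by simp
    next
      case (Suc m)
      have "vec n (\<lambda>i. if i < Suc m then v $ i else 0) =
        vec n (\<lambda>i. if i < m then v $ i else 0) + v $ m \<cdot>\<^sub>v unit_vec n m"
        using Suc.prems by (auto simp: unit_vec_def less_Suc_eq)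
      thus ?case
        using Suc A unit[of m] by (auto simp: poly_act_add_vec[OF A] scale)
    qed
    moreover have "vec n (\<lambda>i. if i < n then v $ i else 0) = v"
      using v by (intro eq_vecI) auto
    ultimately show "poly_act A v f = 0\<^sub>v n"
      by (metis le_refl)
  qed
qed

section \<open>Principal ideals of polynomials and orders of vectors\<close>

lemma poly_ideal_principal:
  fixes I :: "'a :: field poly set"
  assumes I0: "0 \<in> I" and Iadd: "\<And>f g. f \<in> I \<Longrightarrow> g \<in> I \<Longrightarrow> f + g \<in> I"
    and Imul: "\<And>f g. g \<in> I \<Longrightarrow> f * g \<in> I"
  shows "\<exists>c. \<forall>f. f \<in> I \<longleftrightarrow> c dvd f"
proof (cases "I \<subseteq> {0}")
  case True
  thus ?thesis
    using I0 by (intro exI[of _ 0]) auto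
next
  case False
  hence ex: "\<exists>c. c \<in> I \<and> c \<noteq> 0"
    by blast
  define c where "c = arg_min degree (\<lambda>c. c \<in> I \<and> c \<noteq> 0)"
  have c: "c \<in> I" "c \<noteq> 0" and min: "\<And>f. f \<in> I \<Longrightarrow> f \<noteq> 0 \<Longrightarrow> degree c \<le> degree f"
    using arg_min_nat_lemma[of "\<lambda>c. c \<in> I \<and> c \<noteq> 0" _ degree] ex unfolding c_def by blast+
  have "c dvd f" if "f \<in> I" for f
  proof -
    have "f mod c = f + (- (f div c)) * c"
      by (simp add: minus_div_mult_eq_mod[symmetric])
    hence "f mod c \<in> I"
      using Iadd[OF that Imul[OF c(1)]] by metis
    hence "f mod c = 0"
      using min[of "f mod c"] degree_mod_less[OF c(2), of f] by fastforce
    thus ?thesis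
      by (simp add: dvd_eq_mod_eq_0)
  qed
  moreover have "f \<in> I" if "c dvd f" for f
    using that Imul[OF c(1)] by (metis dvdE mult.commute)
  ultimately show ?thesis
    by blast
qed

lemma poly_bezout:
  fixes f g :: "'a :: field poly"
  obtains a b where "a * f + b * g dvd f" "a * f + b * g dvd g"
proof -
  let ?I = "{a * f + b * g | a b. True}"
  have "\<exists>c. \<forall>h. h \<in> ?I \<longleftrightarrow> c dvd h"
  proof (rule poly_ideal_principal)
    show "0 \<in> ?I"
      by (auto intro!: exI[of _ 0])
    show "x + y \<in> ?I" if "x \<in> ?I" "y \<in> ?I" for x y
    proof -
      from that obtain a b a' b' where "x = a * f + b * g" "y = a' * f + b' * g"
        by blast
      hence "x + y = (a + a') * f + (b + b') * g"
        by (simp add: algebra_simps)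
      thus ?thesis
        by blast
    qed
    show "x * y \<in> ?I" if "y \<in> ?I" for x y
    proof -
      from that obtain a b where "y = a * f + b * g"
        by blast
      hence "x * y = (x * a) * f + (x * b) * g"
        by (simp add: algebra_simps)
      thus ?thesis
        by blast
    qed
  qed
  then obtain c where c: "\<And>h. h \<in> ?I \<longleftrightarrow> c dvd h"
    by blast
  have "c \<in> ?I"
    using c by simp
  moreover have "f = 1 * f + 0 * g" "g = 0 * f + 1 * g"
    by simp_all
  hence "f \<in> ?I" "g \<in> ?I"
    by blast+
  ultimately show ?thesis
    using that c by blast
qed

text \<open>A generator of the annihilator ideal of \<open>v\<close>, determined only up to a
  unit.\<close>

definition order_poly :: "'a :: field mat \<Rightarrow> 'a vec \<Rightarrow> 'a poly \<Rightarrow> bool" where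
  "order_poly A v g \<longleftrightarrow> (\<forall>f. poly_act A v f = 0\<^sub>v (dim_row A) \<longleftrightarrow> g dvd f)"

lemma order_poly_exists:
  assumes A: "A \<in> carrier_mat n n" and v: "v \<in> carrier_vec n"
  shows "\<exists>g. order_poly A v g"
proof -
  have "\<exists>c. \<forall>f. f \<in> {f. poly_act A v f = 0\<^sub>v n} \<longleftrightarrow> c dvd f"
    by (rule poly_ideal_principal)
      (use A v in \<open>auto simp: poly_act_add[OF A v] poly_act_mult[OF A v] poly_act_zero_vec[OF A]\<close>)
  thus ?thesis
    using A by (auto simp: order_poly_def)
qed

text \<open>A polynomial \<open>h\<close> kills the new vector iff \<open>f * g\<close> divides
  \<open>h * g\<close>, and \<open>g\<close> cancels.\<close>

lemma order_poly_divisor: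
  assumes A: "A \<in> carrier_mat n n" and v: "v \<in> carrier_vec n"
    and "order_poly A v (f * g)" "g \<noteq> 0"
  shows "order_poly A (poly_act A v g) f"
  unfolding order_poly_def poly_act_mult[OF A v, symmetric]
  using assms by (simp add: order_poly_def)

text \<open>If \<open>f\<close> kills \<open>v + w\<close>, then \<open>h * f\<close> kills
  \<open>v + w\<close> and \<open>w\<close>, hence \<open>v\<close>, so \<open>g\<close> divides
  \<open>h * f\<close>; the Bezout identity reduces this to \<open>g dvd f\<close>. The other factor
  is symmetric.\<close>

lemma order_poly_add:
  assumes A: "A \<in> carrier_mat n n" and v: "v \<in> carrier_vec n" "w \<in> carrier_vec n"
    and g: "order_poly A v g" and h: "order_poly A w h" and coprime: "a * g + b * h = 1"
  shows "order_poly A (v + w) (g * h)"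
  unfolding order_poly_def
proof (intro allI iffI)
  have act: "poly_act A (v + w) f = poly_act A v f + poly_act A w f" for f
    using poly_act_add_vec[OF A v] .
  have zero: "poly_act A v f = 0\<^sub>v n \<longleftrightarrow> g dvd f" "poly_act A w f = 0\<^sub>v n \<longleftrightarrow> h dvd f" for f
    using g h A by (auto simp: order_poly_def)
  fix f
  show "poly_act A (v + w) f = 0\<^sub>v (dim_row A)" if "g * h dvd f"
  proof -
    have "g dvd f" "h dvd f"
      using that by (auto dest: dvd_mult_left dvd_mult_right)
    thus ?thesis
      using A unfolding act by (auto simp flip: zero)
  qed
  assume *: "poly_act A (v + w) f = 0\<^sub>v (dim_row A)"
  have **: "poly_act A (v + w) (r * f) = 0\<^sub>v n" for r
    using * A v by (simp add: poly_act_mult[OF A] poly_act_zero_vec[OF A])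
  have "poly_act A w (h * f) = 0\<^sub>v n" "poly_act A v (g * f) = 0\<^sub>v n"
    unfolding zero by simp_all
  hence "poly_act A v (h * f) = 0\<^sub>v n" "poly_act A w (g * f) = 0\<^sub>v n"
    using **[of h] **[of g] A v unfolding act
    by (metis poly_act_carrier right_zero_vec left_zero_vec)+
  hence gh: "g dvd h * f" "h dvd g * f"
    unfolding zero .
  have f: "f = a * (g * f) + b * (h * f)"
    using arg_cong[OF coprime, of "\<lambda>r. r * f"] by (simp add: algebra_simps)
  have "g dvd f" "h dvd f"
    using gh by (subst f, simp)+
  hence "g * h dvd a * (g * f)" "g * h dvd b * (h * f)"
    using mult_dvd_mono[of g f h h] by (simp_all add: mult.commute dvd_mult)
  thus "g * h dvd f"
    by (subst f) (rule dvd_add)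
qed

text \<open>Let \<open>w\<close> have order \<open>g\<close> of maximal degree, and suppose some order does not divide \<open>g\<close>; take
  such an order \<open>s\<close> of minimal degree. Every proper divisor of \<open>s\<close> divides \<open>g\<close>, so with
  \<open>c = gcd s g\<close> the polynomials \<open>g / c\<close> and \<open>s\<close> are coprime, and \<open>(g / c) * s\<close> is an order of degree
  larger than \<open>g\<close>. This needs no factorisation into irreducibles.\<close>

lemma exists_vector_of_maximal_order:
  fixes A :: "'a :: field mat"
  assumes A: "A \<in> carrier_mat n n" and \<chi>: "\<chi> \<noteq> 0" "\<And>v. v \<in> carrier_vec n \<Longrightarrow> poly_act A v \<chi> = 0\<^sub>v n"
  shows "\<exists>w g. w \<in> carrier_vec n \<and> order_poly A w g \<and> g \<noteq> 0 \<and>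
    (\<forall>v\<in>carrier_vec n. poly_act A v g = 0\<^sub>v n)"
proof -
  have dvd\<chi>: "g dvd \<chi>" if "v \<in> carrier_vec n" "order_poly A v g" for v g
    using that(2) \<chi>(2)[OF that(1)] A unfolding order_poly_def by (metis carrier_matD(1))
  define Q where "Q = (\<lambda>m. \<exists>w g. w \<in> carrier_vec n \<and> order_poly A w g \<and> degree g = m)"
  have bound: "m \<le> degree \<chi>" if "Q m" for m
    using that dvd\<chi> \<chi>(1) by (auto simp: Q_def intro: dvd_imp_degree_le)
  obtain g\<^sub>0 where "order_poly A (0\<^sub>v n) g\<^sub>0"
    using order_poly_exists[OF A zero_carrier_vec] by blast
  hence "Q (degree g\<^sub>0)"
    unfolding Q_def using zero_carrier_vec by blast
  hence "\<exists>m. Q m"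
    by blast
  hence "Q (Greatest Q)"
    using GreatestI_ex_nat[of Q "degree \<chi>"] bound by blast
  then obtain w g where w: "w \<in> carrier_vec n" "order_poly A w g" and deg: "degree g = Greatest Q"
    unfolding Q_def by blast
  have max: "degree h \<le> degree g" if "v \<in> carrier_vec n" "order_poly A v h" for v h
    unfolding deg by (rule Greatest_le_nat[of Q _ "degree \<chi>"]) (use that bound in \<open>auto simp: Q_def\<close>)
  have g0: "g \<noteq> 0"
    using dvd\<chi>[OF w] \<chi>(1) by auto
  have "poly_act A v g = 0\<^sub>v n" if v: "v \<in> carrier_vec n" for v
  proof (rule ccontr)
    assume v0: "poly_act A v g \<noteq> 0\<^sub>v n"
    define R where "R = (\<lambda>s. (\<exists>v\<in>carrier_vec n. order_poly A v s) \<and> \<not> s dvd g)"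
    have "\<exists>s. R s"
      using order_poly_exists[OF A v] v v0 A unfolding R_def order_poly_def by auto
    then obtain s where "R s" and smin: "\<And>t. R t \<Longrightarrow> degree s \<le> degree t"
      using arg_min_nat_lemma[of R _ degree] by blast
    then obtain v where v: "v \<in> carrier_vec n" "order_poly A v s" and ns: "\<not> s dvd g"
      unfolding R_def by blast
    have s0: "s \<noteq> 0"
      using dvd\<chi>[OF v] \<chi>(1) by auto
    \<comment> \<open>By \<open>order_poly_divisor\<close>, \<open>x\<close> is again an order, of
      smaller degree than \<open>s\<close>, so minimality of \<open>s\<close> applies.\<close>
    have proper: "x dvd g" if "s = x * y" "degree y > 0" for x y
    proof (rule ccontr)
      assume "\<not> x dvd g"
      moreover have "order_poly A (poly_act A v y) x"
        using order_poly_divisor[OF A v(1), of x y] v(2) that s0 by auto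
      ultimately have "R x"
        unfolding R_def using A v(1) by (auto intro!: bexI[of _ "poly_act A v y"])
      moreover have "degree s = degree x + degree y"
        unfolding that(1) using s0 that(1) by (intro degree_mult_eq) auto
      ultimately show False
        using smin that(2) by fastforce
    qed
    obtain a b where "a * s + b * g dvd s" "a * s + b * g dvd g"
      using poly_bezout .
    then obtain c y g2 where c: "c = a * s + b * g" "s = c * y" "g = c * g2"
      by (metis dvdE)
    have c0: "c \<noteq> 0" and y0: "y \<noteq> 0" and g20: "g2 \<noteq> 0"
      using c s0 g0 by auto
    have "degree y > 0"
    proof (rule ccontr)
      assume "\<not> degree y > 0"
      hence "y dvd 1"
        using y0 by (simp add: is_unit_iff_degree)
      hence "s dvd c"
        unfolding c(2) by (metis dvd_refl mult_dvd_mono mult.right_neutral)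
      thus False
        using ns c(3) by (metis dvd_mult2)
    qed
    obtain a' b' where "a' * g2 + b' * s dvd g2" "a' * g2 + b' * s dvd s"
      using poly_bezout .
    then obtain r z where r: "r = a' * g2 + b' * s" "r dvd g2" "s = z * r"
      by (metis dvdE mult.commute)
    \<comment> \<open>\<open>r\<close> divides both \<open>g2\<close> and \<open>s\<close>. If it is
      not constant, \<open>z\<close> divides \<open>g\<close>, hence also
      \<open>c = a * s + b * g\<close>, and then \<open>s = z * r\<close> divides
      \<open>c * g2 = g\<close>.\<close>
    have "degree r = 0"
    proof (rule ccontr)
      assume "degree r \<noteq> 0"
      hence "z dvd g"
        using proper[of z r] r(3) by simp
      hence "z dvd c"
        unfolding c(1) using r(3) by simp
      hence "s dvd g"
        unfolding r(3) c(3) using r(2) by (intro mult_dvd_mono)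
      thus False
        using ns by simp
    qed
    moreover have "r \<noteq> 0"
      using r(3) s0 by auto
    ultimately obtain r' where "r' * r = 1"
      by (metis is_unit_iff_degree dvdE mult.commute)
    hence cop: "(r' * a') * g2 + (r' * b') * s = 1"
      unfolding r(1) by (simp add: algebra_simps)
    have "order_poly A (poly_act A w c) g2"
      using order_poly_divisor[OF A w(1), of g2 c] w(2) c(3) c0 by (simp add: mult.commute)
    from order_poly_add[OF A _ v(1) this v(2) cop] A w(1)
    have "order_poly A (poly_act A w c + v) (g2 * s)"
      by auto
    hence "degree (g2 * s) \<le> degree g"
      using max A w(1) v(1) by (metis add_carrier_vec poly_act_carrier)
    moreover have "degree (g2 * s) = degree g2 + (degree c + degree y)"
      using g20 s0 c0 y0 by (simp add: c(2) degree_mult_eq)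
    moreover have "degree g = degree c + degree g2"
      using c0 g20 by (simp add: c(3) degree_mult_eq)
    ultimately show False
      using \<open>degree y > 0\<close> by simp
  qed
  thus ?thesis
    using w g0 by blast
qed

text \<open>A vector of maximal order has an order that annihilates the whole space. For a cyclic
  matrix this order has degree at least \<open>n\<close>, so no nonzero polynomial of smaller degree
  kills the vector.\<close>

lemma cyclic_mat_cyclic_vector:
  fixes A :: "'a :: field mat"
  assumes A: "A \<in> carrier_mat n n" and cyc: "cyclic_mat A"
  shows "\<exists>w\<in>carrier_vec n. \<forall>f. poly_act A w f = 0\<^sub>v n \<longrightarrow> degree f < n \<longrightarrow> f = 0"
proof -
  let ?\<chi> = "char_poly A"
  have deg: "degree ?\<chi> = n"
    using degree_monic_char_poly[OF A] by simp
  have "monic ?\<chi>" "poly_at_mat ?\<chi> A = 0\<^sub>m n n"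
    and min: "\<And>g. g \<noteq> 0 \<Longrightarrow> poly_at_mat g A = 0\<^sub>m n n \<Longrightarrow> n \<le> degree g"
    using cyc A deg by (auto simp: cyclic_mat_def is_min_poly_def)
  have \<chi>0: "?\<chi> \<noteq> 0"
    using \<open>monic ?\<chi>\<close> by (metis leading_coeff_0_iff zero_neq_one)
  have "poly_act A v ?\<chi> = 0\<^sub>v n" if "v \<in> carrier_vec n" for v
    using that \<open>poly_at_mat ?\<chi> A = 0\<^sub>m n n\<close> poly_at_mat_eq_0_iff[OF A] by blast
  from exists_vector_of_maximal_order[OF A \<chi>0 this]
  obtain w g where w: "w \<in> carrier_vec n" "order_poly A w g" "g \<noteq> 0"
    "\<forall>v\<in>carrier_vec n. poly_act A v g = 0\<^sub>v n"
    by blast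
  have "n \<le> degree g"
    using w(4) unfolding poly_at_mat_eq_0_iff[OF A, symmetric] by (rule min[OF w(3)])
  hence "f = 0" if "poly_act A w f = 0\<^sub>v n" "degree f < n" for f
    using that w(2) A dvd_imp_degree_le[of g f] unfolding order_poly_def by (metis carrier_matD(1) leD order.strict_trans1)
  thus ?thesis
    using w(1) by blast
qed

subsection \<open>Splitting a cyclic matrix\<close>

lemma mat_trace_mult_commute:
  fixes A B :: "'a :: comm_semiring_0 mat"
  assumes "A \<in> carrier_mat n m" "B \<in> carrier_mat m n"
  shows "mat_trace (A * B) = mat_trace (B * A)"
proof -
  have "mat_trace (A * B) = (\<Sum>i<n. \<Sum>j<m. A $$ (i, j) * B $$ (j, i))"
    using assms by (simp add: mat_trace_def scalar_prod_def lessThan_atLeast0)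
  also have "\<dots> = (\<Sum>j<m. \<Sum>i<n. B $$ (j, i) * A $$ (i, j))"
    by (subst sum.swap) (simp add: mult.commute)
  also have "\<dots> = mat_trace (B * A)"
    using assms by (simp add: mat_trace_def scalar_prod_def lessThan_atLeast0)
  finally show ?thesis .
qed

lemma poly_act_sum:
  assumes A: "A \<in> carrier_mat n n" and w: "w \<in> carrier_vec n" and i: "i < n"
  shows "poly_act A w (\<Sum>j\<in>J. Polynomial.smult (x j) (f j)) $ i = (\<Sum>j\<in>J. x j * poly_act A w (f j) $ i)"
proof (induction J rule: infinite_finite_induct)
  case (insert j J)
  have "dim_vec (poly_act A w g) = n" for g
    using poly_act_carrier[OF A w] by (rule carrier_vecD)
  thus ?case
    using insert i by (simp add: poly_act_add[OF A w] poly_act_smult[OF A w])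
qed (use A i in auto)

text \<open>Compare coefficients at \<open>n - 1 - j\<close>: earlier terms vanish by induction,
  later ones have smaller degree.\<close>

lemma monic_descending_degrees_independent:
  fixes f :: "nat \<Rightarrow> 'a :: field poly"
  assumes "\<And>j. j < n \<Longrightarrow> degree (f j) = n - 1 - j" "\<And>j. j < n \<Longrightarrow> monic (f j)"
    and "(\<Sum>j<n. Polynomial.smult (x j) (f j)) = 0" "j < n"
  shows "x j = 0"
  using assms(4)
proof (induction j rule: less_induct)
  case (less j)
  have "0 = (\<Sum>i<n. x i * coeff (f i) (n - 1 - j))"
    using arg_cong[OF assms(3), of "\<lambda>p. coeff p (n - 1 - j)"] by (simp add: coeff_sum)
  also have "\<dots> = (\<Sum>i<n. if i = j then x j else 0)"
  proof (rule sum.cong)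
    fix i assume i: "i \<in> {..<n}"
    consider "i < j" | "i = j" | "i > j"
      by linarith
    thus "x i * coeff (f i) (n - 1 - j) = (if i = j then x j else 0)"
    proof cases
      case 3
      hence "coeff (f i) (n - 1 - j) = 0"
        using i assms(1)[of i] by (intro coeff_eq_0) auto
      thus ?thesis
        using 3 by simp
    qed (use less i assms(1,2)[of j] in auto)
  qed simp
  also have "\<dots> = x j"
    using less.prems by simp
  finally show ?case
    by simp
qed

text \<open>For a cyclic vector \<open>w\<close>, the vectors \<open>u j\<close> obtained by
  applying the factors \<open>A - a i\<close> with \<open>i > j\<close> to \<open>w\<close> form a
  basis, and \<open>A\<close> maps \<open>u j\<close> to \<open>u (j - 1) + a j * u j\<close> for
  \<open>j > 0\<close>. Only the image of \<open>u 0\<close> is uncontrolled.\<close>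

lemma cyclic_mat_similar_prescribed_diagonal:
  fixes A :: "'a :: field mat"
  assumes A: "A \<in> carrier_mat n n" and cyc: "cyclic_mat A" and n: "n > 0"
    and a: "(\<Sum>i<n. a i) = mat_trace A"
  shows "\<exists>M P Q. similar_mat_wit A M P Q \<and> M $$ (0, 0) = a 0 \<and>
    (\<forall>i j. i < n \<longrightarrow> 0 < j \<longrightarrow> j < n \<longrightarrow>
      M $$ (i, j) = (if i = j then a j else if Suc i = j then 1 else 0))"
proof -
  obtain w where w: "w \<in> carrier_vec n" 
    and wf: "\<And>f. poly_act A w f = 0\<^sub>v n \<Longrightarrow> degree f < n \<Longrightarrow> f = 0"
    using cyclic_mat_cyclic_vector[OF A cyc] by blast
  define f where "f = (\<lambda>j. \<Prod>i\<in>{Suc j..<n}. [:- a i, 1:])"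
  define u where "u = (\<lambda>j. poly_act A w (f j))"
  have u: "u j \<in> carrier_vec n" for j
    using A w by (simp add: u_def)
  have deg: "degree (f j) = n - 1 - j" for j
    unfolding f_def by (subst degree_prod_eq_sum_degree) auto
  have monic: "monic (f j)" for j
    unfolding f_def by (subst lead_coeff_prod) simp
  have Au: "A *\<^sub>v u j = u (j - 1) + a j \<cdot>\<^sub>v u j" if "0 < j" "j < n" for j
  proof -
    have "{Suc (j - 1)..<n} = insert j {Suc j..<n}"
      using that by auto
    hence "f (j - 1) = [:- a j, 1:] * f j"
      unfolding f_def by simp
    thus ?thesis
      unfolding u_def using poly_act_linear_factor[OF A w, of "f j" "a j"] by metis
  qed
  define P where "P = mat n n (\<lambda>(i, j). u j $ i)"
  have P: "P \<in> carrier_mat n n"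
    by (simp add: P_def)
  have colP: "col P j = u j" if "j < n" for j
    using that u[of j] by (intro eq_vecI) (auto simp: P_def)
  \<comment> \<open>A kernel vector of \<open>P\<close> would give a polynomial of degree below
    \<open>n\<close> that kills the cyclic vector.\<close>
  have "det P \<noteq> 0"
  proof
    assume "det P = 0"
    then obtain x where x: "x \<in> carrier_vec n" "x \<noteq> 0\<^sub>v n" "P *\<^sub>v x = 0\<^sub>v n"
      using det_0_iff_vec_prod_zero_field[OF P] by blast
    let ?g = "\<Sum>j<n. Polynomial.smult (x $ j) (f j)"
    have "poly_act A w ?g = 0\<^sub>v n"
    proof (rule eq_vecI)
      fix i assume i: "i < dim_vec (0\<^sub>v n :: 'a vec)"
      have "poly_act A w ?g $ i = (\<Sum>j<n. x $ j * u j $ i)"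
        using poly_act_sum[OF A w] i by (simp add: u_def)
      also have "\<dots> = (P *\<^sub>v x) $ i"
        using i x(1) by (simp add: P_def scalar_prod_def lessThan_atLeast0 mult.commute)
      finally show "poly_act A w ?g $ i = 0\<^sub>v n $ i"
        using x(3) by simp
    qed (use A w in \<open>auto intro!: carrier_vecD\<close>)
    moreover have "degree ?g < n"
    proof -
      have "degree (Polynomial.smult (x $ j) (f j)) \<le> n - 1" for j
        using degree_smult_le[of "x $ j" "f j"] deg[of j] by linarith
      hence "degree ?g \<le> n - 1"
        by (intro degree_sum_le) auto
      thus ?thesis
        using n by linarith
    qed
    ultimately have "?g = 0"
      using wf by blast
    hence "x $ j = 0" if "j < n" for j
      using monic_descending_degrees_independent[of n f "\<lambda>j. x $ j"] deg monic that by blast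
    hence "x = 0\<^sub>v n"
      using x(1) by (intro eq_vecI) auto
    thus False
      using x(2) by simp
  qed
  from det_non_zero_imp_unit[OF P this, of "()"] obtain Q where
    Q: "Q \<in> carrier_mat n n" "P * Q = 1\<^sub>m n" "Q * P = 1\<^sub>m n"
    by (auto simp: Units_def ring_mat_simps)
  define M where "M = Q * (A * P)"
  have M: "M \<in> carrier_mat n n"
    using A P Q by (simp add: M_def)
  have "P * M * Q = (P * Q) * (A * (P * Q))"
    unfolding M_def using A P Q(1) by (simp add: assoc_mult_mat[of _ n n _ n _ n])
  hence AM: "A = P * M * Q"
    using A Q by simp
  hence sim: "similar_mat_wit A M P Q"
    using A P Q M by (simp add: similar_mat_wit_def Let_def)
  have Mij: "M $$ (i, j) = (if i = j then a j else if Suc i = j then 1 else 0)"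
    if "i < n" "0 < j" "j < n" for i j
  proof -
    have Qu: "Q *\<^sub>v u r = unit_vec n r" if "r < n" for r
      using that Q P colP[of r] by (metis col_mult2 col_one)
    have "col M j = Q *\<^sub>v (A *\<^sub>v u j)"
      unfolding M_def
      by (metis that(3) colP col_mult2[OF Q(1) mult_carrier_mat[OF A P]] col_mult2[OF A P])
    also have "\<dots> = Q *\<^sub>v u (j - 1) + a j \<cdot>\<^sub>v (Q *\<^sub>v u j)"
      using that u Q by (simp add: Au mult_add_distrib_mat_vec[of _ n n] mult_mat_vec[of _ n n])
    also have "\<dots> = unit_vec n (j - 1) + a j \<cdot>\<^sub>v unit_vec n j"
      using that by (simp add: Qu)
    finally have "col M j $ i = (unit_vec n (j - 1) + a j \<cdot>\<^sub>v unit_vec n j) $ i"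
      by simp
    thus ?thesis
      using that M by (auto simp: unit_vec_def)
  qed
  \<comment> \<open>The trace determines the corner entry, as all other diagonal entries are
    known.\<close>
  have "mat_trace A = mat_trace M"
    using mat_trace_mult_commute[of "P * M" n n Q] AM P Q M
      assoc_mult_mat[of Q n n P n M n] by simp
  also have "\<dots> = M $$ (0, 0) + (\<Sum>i\<in>{..<n} - {0}. M $$ (i, i))"
    using n M by (simp add: mat_trace_def sum.remove[of _ 0])
  also have "(\<Sum>i\<in>{..<n} - {0}. M $$ (i, i)) = (\<Sum>i\<in>{..<n} - {0}. a i)"
    by (intro sum.cong) (auto simp: Mij)
  finally have "M $$ (0, 0) = a 0"
    using n sum.remove[of "{..<n}" 0 a] unfolding a[symmetric] by simp
  thus ?thesis
    using sim Mij by blast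
qed

text \<open>The similarity is given by \<open>1 + N\<close>, whose inverse is \<open>1 - N\<close>.\<close>

lemma similar_mat_add:
  fixes X E N :: "'a :: comm_ring_1 mat"
  assumes X: "X \<in> carrier_mat n n" and E: "E \<in> carrier_mat n n" and N: "N \<in> carrier_mat n n"
    and "N * N = 0\<^sub>m n n" "E * N = 0\<^sub>m n n" "X * N + E = N * X"
  shows "similar_mat (X + E) X"
proof -
  let ?P = "1\<^sub>m n + N" and ?Q = "1\<^sub>m n - N"
  have PQ: "?P * ?Q = 1\<^sub>m n"
  proof -
    have "?P * ?Q = (1\<^sub>m n + N) * 1\<^sub>m n - (1\<^sub>m n + N) * N"
      using N by (intro mult_minus_distrib_mat) auto
    also have "(1\<^sub>m n + N) * N = N + N * N"
      using N by (simp add: add_mult_distrib_mat[of _ n n])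
    finally show ?thesis
      using N assms(4) by auto
  qed
  have QP: "?Q * ?P = 1\<^sub>m n"
  proof -
    have "?Q * ?P = 1\<^sub>m n * ?P - N * ?P"
      using N by (intro minus_mult_distrib_mat) auto
    also have "N * ?P = N + N * N"
      using N by (simp add: mult_add_distrib_mat[of _ n n _ n])
    finally show ?thesis
      using N assms(4) by auto
  qed
  have "(X + E) * ?P = (X + E) + (X * N + E * N)"
    using X E N by (simp add: mult_add_distrib_mat[of _ n n _ n] add_mult_distrib_mat[of _ n n])
  also have "\<dots> = X + (X * N + E)"
    using X E N assms(5) by auto
  also have "\<dots> = ?P * X"
    using X N assms(6) by (simp add: add_mult_distrib_mat[of _ n n])
  finally have "?P * X * ?Q = (X + E) * ?P * ?Q"
    by simp
  also have "\<dots> = (X + E) * (?P * ?Q)"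
    using X E N by (intro assoc_mult_mat[of _ n n _ n _ n]) auto
  also have "\<dots> = X + E"
    using X E by (simp add: PQ)
  finally show ?thesis
    unfolding similar_mat_def similar_mat_wit_def Let_def
    using X E N PQ QP by (intro exI[of _ ?P] exI[of _ ?Q]) auto
qed

section \<open>Diagonalisable summands and their \<open>k\<close>-th roots\<close>

lemma similar_mat_power:
  assumes "similar_mat X (Z ^\<^sub>m k)" "X \<in> carrier_mat n n" "Z \<in> carrier_mat n n"
  shows "\<exists>B\<in>carrier_mat n n. X = B ^\<^sub>m k"
proof -
  from assms obtain P Q where PQ: "similar_mat_wit X (Z ^\<^sub>m k) P Q"
    unfolding similar_mat_def by blast
  from similar_mat_witD2[OF assms(2) PQ] assms(3)
  have "similar_mat_wit (P * Z * Q) Z P Q"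
    by (simp add: similar_mat_wit_def Let_def)
  from similar_mat_wit_pow_id[OF this, of k] similar_mat_witD2[OF assms(2) PQ] assms(3)
  show ?thesis
    by (intro bexI[of _ "P * Z * Q"]) auto
qed

lemma mat_diag_pow: "mat_diag n \<gamma> ^\<^sub>m k = mat_diag n (\<lambda>i. \<gamma> i ^ k)"
  for \<gamma> :: "nat \<Rightarrow> 'a :: comm_semiring_1"
  by (induction k) (auto simp: mat_diag_diag mult.commute, auto simp: mat_diag_def)

text \<open>\<open>E\<close> selects the positions belonging to one summand; it will be
  \<open>even\<close> or \<open>odd\<close>.\<close>

definition superdiag_mat :: "nat \<Rightarrow> (nat \<Rightarrow> bool) \<Rightarrow> (nat \<Rightarrow> 'a :: zero) \<Rightarrow> 'a mat" where
  "superdiag_mat n E s = mat n n (\<lambda>(i, j). if Suc i = j \<and> E i then s i else 0)"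

text \<open>The corner is left out, since it belongs to the diagonal.\<close>

definition first_col_mat :: "nat \<Rightarrow> (nat \<Rightarrow> 'a :: zero) \<Rightarrow> 'a mat" where
  "first_col_mat n v = mat n n (\<lambda>(i, j). if j = 0 \<and> 0 < i then v i else 0)"

lemma superdiag_mat_mult_eq_0:
  fixes s t :: "nat \<Rightarrow> 'a :: semiring_1"
  assumes "\<And>i. E i \<Longrightarrow> \<not> E (Suc i)"
  shows "superdiag_mat n E s * superdiag_mat n E t = 0\<^sub>m n n"
  using assms
  by (intro eq_matI) (auto simp: superdiag_mat_def scalar_prod_def intro!: sum.neutral)

text \<open>No two selected positions are adjacent, so the matrix consists of blocks of size at most
  two, whose eigenvalues are distinct. The entries of \<open>?N\<close> solve the resulting linear
  equations.\<close>

lemma similar_mat_superdiag: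
  fixes c :: "nat \<Rightarrow> 'a :: field"
  assumes E: "\<And>i. E i \<Longrightarrow> \<not> E (Suc i)"
    and c: "\<And>i. E i \<Longrightarrow> Suc i < n \<Longrightarrow> c i \<noteq> c (Suc i)"
  shows "similar_mat (mat_diag n c + superdiag_mat n E (\<lambda>_. 1)) (mat_diag n c)"
proof (rule similar_mat_add)
  let ?s = "\<lambda>i. 1 / (c (Suc i) - c i)"
  let ?N = "superdiag_mat n E ?s"
  show "mat_diag n c * ?N + superdiag_mat n E (\<lambda>_. 1) = ?N * mat_diag n c"
  proof (rule eq_matI)
    fix i j assume ij: "i < dim_row (?N * mat_diag n c)" "j < dim_col (?N * mat_diag n c)"
    have N: "?N \<in> carrier_mat n n"
      by (simp add: superdiag_mat_def)
    have "c i * ?s i + 1 = ?s i * c (Suc i)" if "E i" "Suc i < n"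
      using c[OF that] by (simp add: field_simps)
    thus "(mat_diag n c * ?N + superdiag_mat n E (\<lambda>_. 1)) $$ (i, j) = (?N * mat_diag n c) $$ (i, j)"
      using ij unfolding mat_diag_mult_left[OF N] mat_diag_mult_right[OF N]
      by (auto simp: superdiag_mat_def)
  qed (auto simp: superdiag_mat_def mat_diag_def)
qed (auto simp: superdiag_mat_mult_eq_0 E, auto simp: superdiag_mat_def)

text \<open>Since \<open>\<not> E 0\<close>, row \<open>0\<close> of \<open>J\<close> has only its
  diagonal entry \<open>c 0\<close>, so \<open>W * J\<close> is \<open>c 0\<close> times
  \<open>W\<close> for a first-column matrix \<open>W\<close>. The column of \<open>W\<close> then
  solves a linear system, solvable because \<open>c 0\<close> differs from the other diagonal
  entries.\<close>

lemma similar_mat_first_col: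
  fixes c v :: "nat \<Rightarrow> 'a :: field"
  assumes E: "\<And>i. E i \<Longrightarrow> \<not> E (Suc i)" "\<not> E 0"
    and c: "\<And>i. 0 < i \<Longrightarrow> i < n \<Longrightarrow> c i \<noteq> c 0"
  defines "J \<equiv> mat_diag n c + superdiag_mat n E (\<lambda>_. 1)"
  shows "similar_mat (J + first_col_mat n v) J"
proof (rule similar_mat_add)
  \<comment> \<open>\<open>z\<close> solves the rows without a superdiagonal entry. A row with one
    refers to the next row, which has none, so a single back substitution suffices.\<close>
  define z where "z = (\<lambda>i. - v i / (c i - c 0))"
  define w where "w = (\<lambda>i. if i = 0 then 0 else
    if E i \<and> Suc i < n then (- v i - z (Suc i)) / (c i - c 0) else z i)"
  have eq: "c i * w i + (if E i \<and> Suc i < n then w (Suc i) else 0) + v i = w i * c 0" if "0 < i" "i < n" for i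
  proof -
    have "(c i - c 0) * w i + (if E i \<and> Suc i < n then w (Suc i) else 0) + v i = 0"
      using that c[OF that] E(1)[of i] by (auto simp: w_def z_def)
    thus ?thesis
      by (simp add: algebra_simps)
  qed
  let ?W = "first_col_mat n w"
  have J: "J $$ (i, r) = (if r = i then c i else 0) + (if r = Suc i then (if E i then 1 else 0) else 0)"
    if "i < n" "r < n" for i r
    using that by (auto simp: J_def mat_diag_def superdiag_mat_def)
  show car: "J \<in> carrier_mat n n" "first_col_mat n v \<in> carrier_mat n n" "?W \<in> carrier_mat n n"
    by (simp_all add: J_def superdiag_mat_def first_col_mat_def mat_diag_def)
  have zero: "first_col_mat n x * first_col_mat n y = 0\<^sub>m n n" for x y :: "nat \<Rightarrow> 'a"
    by (intro eq_matI) (auto simp: first_col_mat_def scalar_prod_def intro!: sum.neutral)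
  show "?W * ?W = 0\<^sub>m n n" "first_col_mat n v * ?W = 0\<^sub>m n n"
    by (rule zero)+
  show "J * ?W + first_col_mat n v = ?W * J"
  proof (rule eq_matI)
    fix i j assume "i < dim_row (?W * J)" "j < dim_col (?W * J)"
    hence ij: "i < n" "j < n"
      using car by auto
    have "(J * ?W) $$ (i, j) = (\<Sum>r<n. J $$ (i, r) * ?W $$ (r, j))"
      using car ij by (simp add: scalar_prod_def lessThan_atLeast0)
    also have "\<dots> = (\<Sum>r<n. (if r = i then c i * ?W $$ (r, j) else 0) +
      (if r = Suc i then (if E i then ?W $$ (r, j) else 0) else 0))"
      by (intro sum.cong) (auto simp: J ij)
    also have "\<dots> = c i * ?W $$ (i, j) + (if E i \<and> Suc i < n then ?W $$ (Suc i, j) else 0)"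
      using ij by (simp add: sum.distrib)
    finally have l: "(J * ?W) $$ (i, j) = \<dots>" .
    have "(?W * J) $$ (i, j) = (\<Sum>r<n. ?W $$ (i, r) * J $$ (r, j))"
      using car ij by (simp add: scalar_prod_def lessThan_atLeast0)
    also have "\<dots> = (\<Sum>r<n. if r = 0 then ?W $$ (i, 0) * J $$ (0, j) else 0)"
      by (intro sum.cong) (use ij in \<open>auto simp: first_col_mat_def\<close>)
    also have "\<dots> = ?W $$ (i, 0) * J $$ (0, j)"
      using ij by simp
    finally have r: "(?W * J) $$ (i, j) = \<dots>" .
    have "c i * ?W $$ (i, j) + (if E i \<and> Suc i < n then ?W $$ (Suc i, j) else 0) +
      first_col_mat n v $$ (i, j) = ?W $$ (i, 0) * J $$ (0, j)"
      using ij eq[of i] E(2) J[of 0 j] by (auto simp: first_col_mat_def)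
    thus "(J * ?W + first_col_mat n v) $$ (i, j) = (?W * J) $$ (i, j)"
      using l r ij car by simp
  qed (use car in auto)
qed

text \<open>Distribute the superdiagonal of the matrix similar to \<open>A\<close> alternately to the two summands, and
  give its first column to the second one. The inequalities make both summands diagonalisable.\<close>

lemma cyclic_mat_sum_of_powers:
  fixes A :: "'a :: field mat"
  assumes A: "A \<in> carrier_mat n n" and cyc: "cyclic_mat A" and n: "n > 0"
    and tr: "(\<Sum>i<n. \<beta> i ^ k + \<gamma> i ^ k) = mat_trace A"
    and \<beta>: "\<And>i. even i \<Longrightarrow> Suc i < n \<Longrightarrow> \<beta> i ^ k \<noteq> \<beta> (Suc i) ^ k"
    and \<gamma>: "\<And>i. odd i \<Longrightarrow> Suc i < n \<Longrightarrow> \<gamma> i ^ k \<noteq> \<gamma> (Suc i) ^ k"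
    and \<gamma>0: "\<And>i. 0 < i \<Longrightarrow> i < n \<Longrightarrow> \<gamma> i ^ k \<noteq> \<gamma> 0 ^ k"
  shows "\<exists>B C. B \<in> carrier_mat n n \<and> C \<in> carrier_mat n n \<and> A = B ^\<^sub>m k + C ^\<^sub>m k"
proof -
  obtain M P Q where sim: "similar_mat_wit A M P Q" and M0: "M $$ (0, 0) = \<beta> 0 ^ k + \<gamma> 0 ^ k"
    and Mij: "\<And>i j. i < n \<Longrightarrow> 0 < j \<Longrightarrow> j < n \<Longrightarrow>
      M $$ (i, j) = (if i = j then \<beta> j ^ k + \<gamma> j ^ k else if Suc i = j then 1 else 0)"
    using cyclic_mat_similar_prescribed_diagonal[OF A cyc n tr] by blast
  note car = similar_mat_witD2[OF A sim]
  let ?X = "mat_diag n (\<lambda>i. \<beta> i ^ k) + superdiag_mat n even (\<lambda>_. 1)"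
  let ?J = "mat_diag n (\<lambda>i. \<gamma> i ^ k) + superdiag_mat n odd (\<lambda>_. 1)"
  let ?Y = "?J + first_col_mat n (\<lambda>i. M $$ (i, 0))"
  have XY: "?X \<in> carrier_mat n n" "?Y \<in> carrier_mat n n"
    by (simp_all add: superdiag_mat_def first_col_mat_def)
  have "M = ?X + ?Y"
    by (rule eq_matI)
      (use car M0 Mij in \<open>auto simp: superdiag_mat_def first_col_mat_def mat_diag_def\<close>)
  have "similar_mat ?X (mat_diag n \<beta> ^\<^sub>m k)"
    unfolding mat_diag_pow by (rule similar_mat_superdiag) (use \<beta> in auto)
  then obtain B where B: "B \<in> carrier_mat n n" "?X = B ^\<^sub>m k"
    using similar_mat_power[OF _ XY(1)] by (metis mat_diag_dim)
  have "similar_mat ?Y ?J"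
    by (rule similar_mat_first_col) (use \<gamma>0 in auto)
  moreover have "similar_mat ?J (mat_diag n \<gamma> ^\<^sub>m k)"
    unfolding mat_diag_pow by (rule similar_mat_superdiag) (use \<gamma> in auto)
  ultimately have "similar_mat ?Y (mat_diag n \<gamma> ^\<^sub>m k)"
    by (rule similar_mat_trans)
  then obtain C where C: "C \<in> carrier_mat n n" "?Y = C ^\<^sub>m k"
    using similar_mat_power[OF _ XY(2)] by (metis mat_diag_dim)
  have conj: "(P * Z * Q) ^\<^sub>m k = P * Z ^\<^sub>m k * Q" if "Z \<in> carrier_mat n n" for Z
    by (rule similar_mat_wit_pow_id) (use that car in \<open>simp add: similar_mat_wit_def Let_def\<close>)
  have "A = P * (B ^\<^sub>m k + C ^\<^sub>m k) * Q"
    using car(3) \<open>M = ?X + ?Y\<close> B(2) C(2) by simp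
  also have "\<dots> = P * B ^\<^sub>m k * Q + P * C ^\<^sub>m k * Q"
    using car B(1) C(1)
    by (simp add: mult_add_distrib_mat[of _ n n _ n] add_mult_distrib_mat[of _ n n])
  also have "\<dots> = (P * B * Q) ^\<^sub>m k + (P * C * Q) ^\<^sub>m k"
    using B(1) C(1) by (simp add: conj)
  finally show ?thesis
    using car B(1) C(1) by (intro exI[of _ "P * B * Q"] exI[of _ "P * C * Q"]) auto
qed

text \<open>Position \<open>i\<close> of the superdiagonal is labelled by two distinct eigenvalues \<open>u i\<close>, \<open>v i\<close>, which
  become entries \<open>i\<close> and \<open>i + 1\<close> of the diagonal of the summand owning that position. The diagonal
  entry \<open>0\<close> of the second summand is \<open>0\<close>, and the entry left over at the other end is \<open>1\<close>.\<close>

lemma cyclic_mat_sum_of_powers_labelled: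
  fixes A :: "'a :: field mat"
  assumes A: "A \<in> carrier_mat n n" and cyc: "cyclic_mat A" and n: "n \<ge> 2" and k: "k \<ge> 1"
    and uv: "\<And>i. i < n - 1 \<Longrightarrow> u i \<noteq> v i \<and> u i \<in> insert 0 (nonzero_powers k) \<and>
      v i \<in> insert 0 (nonzero_powers k) \<and> (odd i \<longrightarrow> u i \<noteq> 0 \<and> v i \<noteq> 0)"
    and tr: "(\<Sum>i<n - 1. u i + v i) = mat_trace A - 1"
  shows "\<exists>B C. B \<in> carrier_mat n n \<and> C \<in> carrier_mat n n \<and> A = B ^\<^sub>m k + C ^\<^sub>m k"
proof -
  define x where "x = (\<lambda>i. if Suc i < n then u i else 1)"
  define y where "y = (\<lambda>i. if i = 0 then 0 else v (i - 1))"
  \<comment> \<open>The first summand owns the even positions \<open>i\<close>, with entries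
    \<open>x i\<close> and \<open>y (i + 1)\<close> there; the second owns the odd ones.\<close>
  define b where "b = (\<lambda>i. if even i then x i else y i)"
  define c where "c = (\<lambda>i. if even i then y i else x i)"
  have "\<exists>z. z ^ k = a" if "a \<in> insert 0 (nonzero_powers k)" for a :: 'a
  proof (cases "a = 0")
    case True
    thus ?thesis
      using k by (intro exI[of _ 0]) simp
  qed (use that in \<open>auto simp: nonzero_powers_def\<close>)
  moreover have "x i \<in> insert 0 (nonzero_powers k)" "y i \<in> insert 0 (nonzero_powers k)" if "i < n" for i
    using that uv[of i] uv[of "i - 1"] one_in_nonzero_powers[of k] by (auto simp: x_def y_def)
  ultimately have "\<forall>i\<in>{..<n}. \<exists>z. z ^ k = b i" "\<forall>i\<in>{..<n}. \<exists>z. z ^ k = c i"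
    by (auto simp: b_def c_def)
  then obtain \<beta> \<gamma> where \<beta>\<gamma>: "\<And>i. i < n \<Longrightarrow> \<beta> i ^ k = b i" "\<And>i. i < n \<Longrightarrow> \<gamma> i ^ k = c i"
    unfolding lessThan_iff by (metis (no_types, lifting) bchoice lessThan_iff)
  have xy: "x i \<noteq> y (Suc i)" if "Suc i < n" for i
    using that uv[of i] by (auto simp: x_def y_def)
  obtain m where m: "n = Suc m"
    using n by (metis Suc_le_D numeral_2_eq_2)
  have "(\<Sum>i<n. \<beta> i ^ k + \<gamma> i ^ k) = (\<Sum>i<n. x i + y i)"
    by (intro sum.cong) (auto simp: \<beta>\<gamma> b_def c_def)
  also have "\<dots> = (\<Sum>i<n. x i) + (\<Sum>i<n. y i)"
    by (rule sum.distrib)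
  also have "(\<Sum>i<n. x i) = (\<Sum>i<m. u i) + 1"
    by (simp add: m x_def)
  also have "(\<Sum>i<n. y i) = (\<Sum>i<m. v i)"
    unfolding m by (subst sum.lessThan_Suc_shift) (simp add: y_def)
  finally have sum: "(\<Sum>i<n. \<beta> i ^ k + \<gamma> i ^ k) = mat_trace A"
    using tr by (simp add: m sum.distrib algebra_simps)
  \<comment> \<open>As \<open>c 0 = 0\<close>, its later entries must be nonzero. They are labels of
    odd positions or the final \<open>1\<close>, so zero labels at even positions do no
    harm.\<close>
  have nz: "c i \<noteq> 0" if "0 < i" "i < n" for i
    using that uv[of i] uv[of "i - 1"] by (auto simp: c_def x_def y_def)
  show ?thesis
  proof (rule cyclic_mat_sum_of_powers[OF A cyc _ sum])
    show "\<beta> i ^ k \<noteq> \<beta> (Suc i) ^ k" if "even i" "Suc i < n" for i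
      using that xy[of i] by (simp add: \<beta>\<gamma> b_def)
    show "\<gamma> i ^ k \<noteq> \<gamma> (Suc i) ^ k" if "odd i" "Suc i < n" for i
      using that xy[of i] by (simp add: \<beta>\<gamma> c_def)
    show "\<gamma> i ^ k \<noteq> \<gamma> 0 ^ k" if "0 < i" "i < n" for i
      using that nz[of i] n by (simp add: \<beta>\<gamma>) (simp add: c_def y_def)
  qed (use n in simp)
qed

section \<open>Assembly according to the number of nonzero powers\<close>

theorem theorem1p12:
  fixes p l q n k d ell :: nat
    and F :: "'a :: {field, finite} set"
  assumes "prime p"
    and "q = p ^ l"
    and "CARD('a) = q"
    and "n \<ge> 2"
    and "k \<ge> 1"
    and "d = gcd k (q - 1)"
    and "ell dvd l"
    and "is_subfield F"
    and "card F = p ^ ell"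
    and "power_sums k = F"
    and "d \<noteq> q - 1"
  shows "q - 1 \<ge> d * (ell + 1) \<and>
    ((q - 1 \<noteq> d * (ell + 1) \<and> n > ell * (p - 1)) \<or> n > (ell + 1) * (p - 1) \<longrightarrow>
      (\<forall>A :: 'a mat. A \<in> carrier_mat n n \<and> cyclic_mat A \<and> mat_trace A \<in> F \<longrightarrow>
        (\<exists>B C. B \<in> carrier_mat n n \<and> C \<in> carrier_mat n n \<and> A = B ^\<^sub>m k + C ^\<^sub>m k))) \<and>
    (ell = l \<and> ((q - 1 \<noteq> d * (l + 1) \<and> n > l * (p - 1)) \<or> n > (l + 1) * (p - 1)) \<longrightarrow>
      (\<forall>A :: 'a mat. A \<in> carrier_mat n n \<and> cyclic_mat A \<longrightarrow>
        (\<exists>B C. B \<in> carrier_mat n n \<and> C \<in> carrier_mat n n \<and> A = B ^\<^sub>m k + C ^\<^sub>m k)))"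
proof -
  let ?H = "nonzero_powers k :: 'a set"
  note F = assms(8-10)
  note FD = is_subfieldD[OF F(1)]
  have p: "prime p" "of_nat p = (0 :: 'a)"
    using assms(1) of_nat_CARD_eq_0[where 'a = 'a] unfolding assms(2,3) by simp_all
  have d0: "d > 0"
    using assms(5,6) by simp
  \<comment> \<open>\<open>d \<noteq> q - 1\<close> means that \<open>q - 1\<close> does not divide
    \<open>k\<close>, so some nonzero \<open>k\<close>-th power differs from
    \<open>1\<close>.\<close>
  obtain h where h: "h \<in> ?H" "h \<noteq> 1"
  proof -
    have "\<not> q - 1 dvd k"
      using assms(6,11) by (metis gcd_nat.absorb2)
    then obtain x :: 'a where "x \<noteq> 0" "x ^ k \<noteq> 1"
      using CARD_minus_1_dvd_exponent[where 'a = 'a, of k] assms(3) by blast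
    thus ?thesis
      using power_in_nonzero_powers that by blast
  qed
  have ellH: "ell < card ?H"
    using exponent_less_card_nonzero_powers[OF p assms(5) h] F by simp
  have H2: "card ?H \<ge> 2"
    using card_mono[of ?H "{1, h}"] h one_in_nonzero_powers[where 'a = 'a, of k] by simp
  have "d * (ell + 1) \<le> d * card ?H"
    using ellH by (intro mult_le_mono2) simp
  also have "\<dots> \<le> q - 1"
    using card_nonzero_powers_le[where 'a = 'a, OF assms(5)] assms(3,6) by simp
  finally have first: "q - 1 \<ge> d * (ell + 1)" .
  have main: "\<exists>B C. B \<in> carrier_mat n n \<and> C \<in> carrier_mat n n \<and> A = B ^\<^sub>m k + C ^\<^sub>m k"
    if size: "(q - 1 \<noteq> d * (ell + 1) \<and> n > ell * (p - 1)) \<or> n > (ell + 1) * (p - 1)"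
      and A: "A \<in> carrier_mat n n" "cyclic_mat A" "mat_trace A \<in> F" for A :: "'a mat"
  proof -
    \<comment> \<open>The two diagonal entries not labelled by positions are \<open>0\<close> and
      \<open>1\<close>, which leaves the trace minus \<open>1\<close>.\<close>
    have t: "mat_trace A - 1 \<in> F"
      using A(3) FD by blast
    have "\<exists>u v :: nat \<Rightarrow> 'a. (\<forall>i<n - 1. u i \<noteq> v i \<and> u i \<in> insert 0 ?H \<and> v i \<in> insert 0 ?H \<and>
        (odd i \<longrightarrow> u i \<noteq> 0 \<and> v i \<noteq> 0)) \<and> (\<Sum>i<n - 1. u i + v i) = mat_trace A - 1"
    proof (cases "card ?H = 2")
      case False
      have "n - 1 \<ge> ell * (p - 1)"
        using size by auto
      with sum_of_distinct_pairs[OF p assms(5) F _ _ t, of "n - 1"] False H2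
      obtain u v where "\<forall>i<n - 1. u i \<in> ?H \<and> v i \<in> ?H \<and> u i \<noteq> v i"
        "(\<Sum>i<n - 1. u i + v i) = mat_trace A - 1"
        by auto
      thus ?thesis
        using nonzero_powers_nonzero by blast
    next
      case True
      note signs = nonzero_powers_eq_signs[OF True]
      have "ell \<noteq> 0"
      proof
        assume "ell = 0"
        hence "card F = 1"
          using F(2) by simp
        moreover have "card F \<ge> card {0, 1 :: 'a}"
          using FD by (intro card_mono) auto
        ultimately show False
          by simp
      qed
      hence ell: "ell = 1"
        using ellH True by simp
      have "q - 1 dvd 2 * d"
        using signs(3) assms(3,6) by simp
      moreover have "q - 1 \<ge> 2 * d"
        using first ell by simp
      ultimately have "q - 1 = 2 * d"
        using d0 by (meson dvd_imp_le le_antisym mult_pos_pos zero_less_numeral)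
      \<comment> \<open>Now \<open>q - 1 = d * (ell + 1)\<close>, which excludes the first
        alternative of the bound on \<open>n\<close>.\<close>
      hence "n > 2 * (p - 1)"
        using size ell by (simp add: mult.commute)
      hence "(n - 1 + 1) div 2 \<ge> ell * (p - 1)"
        using ell by simp
      from sum_of_sign_pairs[OF p assms(5) F signs(1,2) this t] show ?thesis .
    qed
    then obtain u v :: "nat \<Rightarrow> 'a" where uv: "\<forall>i<n - 1. u i \<noteq> v i \<and> u i \<in> insert 0 ?H \<and>
        v i \<in> insert 0 ?H \<and> (odd i \<longrightarrow> u i \<noteq> 0 \<and> v i \<noteq> 0)"
        "(\<Sum>i<n - 1. u i + v i) = mat_trace A - 1"
      by blast
    show ?thesis
      by (rule cyclic_mat_sum_of_powers_labelled[OF A(1,2) assms(4,5) _ uv(2)]) (use uv(1) in blast)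
  qed
  \<comment> \<open>By cardinality, so the trace condition becomes void.\<close>
  have "F = UNIV" if "ell = l"
    using that F(2) assms(2,3) by (intro card_subset_eq) auto
  thus ?thesis
    using first main by auto
qed

end
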